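(* The asymptotic density of the set $\mathfrak{M}:=\{n \in \mathbb{N} : \mathbf{G}_n(n) \equiv 0 \pmod n\}$ is $0.971000\dots$; that is, the density $\delta(\mathfrak{M})$ exists and its decimal expansion begins with $0.971000$ (i.e. $0.971000\le\delta(\mathfrak{M})<0.971001$).
   Context: $\mathbb{N}$ denotes the positive integers. For integers $k,n\ge 1$, $\mathbf{G}_k(n):=\sum_{1\leq a,b\leq n}(a+bi)^k\in\mathbb{Z}[i]$, and congruence modulo $n$ is modulo the ideal $n\mathbb{Z}[i]$. The asymptotic density of $A\subseteq\mathbb{N}$ is $\delta(A)=\lim_{N\to\infty}\frac{1}{N}\#(A\cap[1,N])$, when the limit exists. *)

theory Defs
  imports Complex_Main
begin

definition gaussian_ints :: "complex set" where
  "gaussian_ints = {of_int x + of_int y * \<i> | x y. True}"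

text \<open>Congruence of Gaussian integers modulo the principal ideal generated by \<open>n\<close>. The
  quotient is required to lie in \<^const>\<open>gaussian_ints\<close>: plain divisibility on
  \<^typ>\<open>complex\<close> would be trivial, as that type is a field.\<close>

definition gaussian_cong :: "complex \<Rightarrow> complex \<Rightarrow> nat \<Rightarrow> bool" where
  "gaussian_cong z w n \<longleftrightarrow>
     z \<in> gaussian_ints \<and> w \<in> gaussian_ints \<and> (\<exists>q\<in>gaussian_ints. z - w = of_nat n * q)"

definition gaussian_power_sum :: "nat \<Rightarrow> nat \<Rightarrow> complex" where
  "gaussian_power_sum k n = (\<Sum>a=1..n. \<Sum>b=1..n. (of_nat a + of_nat b * \<i>) ^ k)"

definition M_set :: "nat set" where
  "M_set = {n. n \<ge> 1 \<and> gaussian_cong (gaussian_power_sum n n) 0 n}"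

text \<open>The density exists and equals \<open>d\<close>; the (irrelevant) term at \<open>N = 0\<close> is \<open>0 / 0 = 0\<close>.\<close>

definition has_asymptotic_density :: "nat set \<Rightarrow> real \<Rightarrow> bool" where
  "has_asymptotic_density A d \<longleftrightarrow>
     (\<lambda>N. real (card (A \<inter> {1..N})) / real N) \<longlonglongrightarrow> d"

end

theory Submission
  imports Defs "HOL-Number_Theory.Number_Theory" "HOL-Computational_Algebra.Polynomial"
begin

text \<open>
  Write \<open>G\<close> for the sum of the \<open>n\<close>-th powers of all Gaussian residues modulo \<open>n\<close>. Because the exponent
  equals the modulus, the summands modulo \<open>p\<^sup>e\<close> depend only on the base modulo \<open>p\<close> whenever \<open>p\<^sup>e\<close> divides
  \<open>n\<close> (\<open>gaussian_cong_power_lift\<close>). Hence \<open>G\<close> is congruent to \<open>(n/p)\<^sup>2\<close> times the sum of the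
  \<open>n\<close>-th powers over \<open>\<int>[\<i>]/p\<close> (\<open>gaussian_power_sum_reduce\<close>). If \<open>p\<^sup>2\<close> divides \<open>n\<close>, the factor \<open>(n/p)\<^sup>2\<close>
  already vanishes modulo \<open>p\<^sup>e\<close>. If \<open>p\<close> divides \<open>n\<close> exactly once, the ring \<open>\<int>[\<i>]/p\<close> decides: the sum
  is \<open>0\<close> for \<open>p = 2\<close> and for split \<open>p \<equiv> 1 (mod 4)\<close>, while for inert \<open>p \<equiv> 3 (mod 4)\<close> the ring is the field
  with \<open>p\<^sup>2\<close> elements and the sum is \<open>-1\<close> or \<open>0\<close> according to whether \<open>p\<^sup>2 - 1\<close> divides \<open>n\<close> or not. So the
  set consists of the \<open>n\<close> for which no prime \<open>p \<equiv> 3 (mod 4)\<close> satisfies \<open>p (p\<^sup>2 - 1) | n\<close> and \<open>p\<^sup>2 \<nmid> n\<close>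
  (\<open>M_set_iff\<close>).

  The complement is thus a union of sets \<open>B\<^sub>p\<close>, each periodic and of density at most
  \<open>1 / (p (p\<^sup>2 - 1))\<close>. Finite unions of them have a density, and since the series of these bounds
  converges, so does the whole union (\<open>density_bad_exists\<close>).

  For the value, every \<open>p > 3\<close> congruent to \<open>3\<close> modulo \<open>4\<close> has \<open>24 | p\<^sup>2 - 1\<close>. The set \<open>B\<^sub>3\<close>, given by
  \<open>24 | n\<close> and \<open>9 \<nmid> n\<close>, has density \<open>1/36\<close> and absorbs everything except the multiples of \<open>72\<close>. Among
  these, the contribution of \<open>31\<close> chosen primes is enclosed by inclusion and exclusion, cut off at large
  moduli (\<open>density_bounds\<close>, \<open>density_bounds_sound\<close>). All other primes together contribute at most about
  \<open>4.1 \<cdot> 10\<^sup>-\<^sup>7\<close>. The resulting enclosure of the density of the complement lies strictly inside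
  \<open>[0.028999, 0.029]\<close> (\<open>density_bad_bounds\<close>).
\<close>

section \<open>Congruences between Gaussian integers\<close>

lemma gaussian_intsE:
  assumes "z \<in> gaussian_ints"
  obtains x y where "z = of_int x + of_int y * \<i>"
  using assms by (auto simp: gaussian_ints_def)

lemma gaussian_ints_intro [simp, intro]: "of_int x + of_int y * \<i> \<in> gaussian_ints"
  by (auto simp: gaussian_ints_def)

lemma gaussian_ints_of_int [simp, intro]: "of_int x \<in> gaussian_ints"
  using gaussian_ints_intro[of x 0] by simp

lemma gaussian_ints_of_nat [simp, intro]: "of_nat x \<in> gaussian_ints"
  using gaussian_ints_of_int[of "int x"] by simp

lemma gaussian_ints_0 [simp, intro]: "0 \<in> gaussian_ints"
  using gaussian_ints_of_int[of 0] by simp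

lemma gaussian_ints_1 [simp, intro]: "1 \<in> gaussian_ints"
  using gaussian_ints_of_int[of 1] by simp

lemma gaussian_ints_ii [simp, intro]: "\<i> \<in> gaussian_ints"
  using gaussian_ints_intro[of 0 1] by simp

lemma gaussian_ints_add [simp, intro]:
  assumes "z \<in> gaussian_ints" "w \<in> gaussian_ints"
  shows "z + w \<in> gaussian_ints"
proof -
  obtain x y u v where "z = of_int x + of_int y * \<i>" "w = of_int u + of_int v * \<i>"
    using assms by (metis gaussian_intsE)
  then have "z + w = of_int (x + u) + of_int (y + v) * \<i>" by (simp add: algebra_simps)
  then show ?thesis by (metis gaussian_ints_intro)
qed

lemma gaussian_ints_mult [simp, intro]:
  assumes "z \<in> gaussian_ints" "w \<in> gaussian_ints"
  shows "z * w \<in> gaussian_ints"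
proof -
  obtain x y u v where "z = of_int x + of_int y * \<i>" "w = of_int u + of_int v * \<i>"
    using assms by (metis gaussian_intsE)
  then have "z * w = of_int (x * u - y * v) + of_int (x * v + y * u) * \<i>"
    by (simp add: algebra_simps)
  then show ?thesis by (metis gaussian_ints_intro)
qed

lemma gaussian_ints_uminus [simp, intro]: "z \<in> gaussian_ints \<Longrightarrow> - z \<in> gaussian_ints"
  using gaussian_ints_mult[OF gaussian_ints_of_int[of "-1"], of z] by simp

lemma gaussian_ints_diff [simp, intro]:
  "z \<in> gaussian_ints \<Longrightarrow> w \<in> gaussian_ints \<Longrightarrow> z - w \<in> gaussian_ints"
  using gaussian_ints_add[of z "- w"] by simp

lemma gaussian_ints_power [simp, intro]: "z \<in> gaussian_ints \<Longrightarrow> z ^ k \<in> gaussian_ints"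
  by (induction k) auto

lemma gaussian_ints_sum [simp, intro]:
  "(\<And>x. x \<in> A \<Longrightarrow> f x \<in> gaussian_ints) \<Longrightarrow> sum f A \<in> gaussian_ints"
  by (induction A rule: infinite_finite_induct) auto

lemma gaussian_ints_prod [simp, intro]:
  "(\<And>x. x \<in> A \<Longrightarrow> f x \<in> gaussian_ints) \<Longrightarrow> prod f A \<in> gaussian_ints"
  by (induction A rule: infinite_finite_induct) auto

lemma gaussian_congD: "gaussian_cong z w m \<Longrightarrow> z \<in> gaussian_ints \<and> w \<in> gaussian_ints"
  by (simp add: gaussian_cong_def)

lemma gaussian_congI:
  "w \<in> gaussian_ints \<Longrightarrow> q \<in> gaussian_ints \<Longrightarrow> z = w + of_nat m * q \<Longrightarrow> gaussian_cong z w m"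
  by (auto simp: gaussian_cong_def)

lemma gaussian_congE:
  assumes "gaussian_cong z w m"
  obtains q where "q \<in> gaussian_ints" "z = w + of_nat m * q"
  using assms by (auto simp: gaussian_cong_def algebra_simps)

lemma gaussian_cong_refl [simp, intro]: "z \<in> gaussian_ints \<Longrightarrow> gaussian_cong z z m"
  by (rule gaussian_congI[of z 0]) auto

lemma gaussian_cong_sym: "gaussian_cong z w m \<Longrightarrow> gaussian_cong w z m"
  by (metis gaussian_congD gaussian_congE gaussian_congI gaussian_ints_uminus
      add_diff_cancel_right' diff_add_cancel mult_minus_right add_uminus_conv_diff)

lemma gaussian_cong_add:
  assumes "gaussian_cong z w m" "gaussian_cong u v m"
  shows "gaussian_cong (z + u) (w + v) m"
proof -
  obtain q r where "q \<in> gaussian_ints" "z = w + of_nat m * q"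
    "r \<in> gaussian_ints" "u = v + of_nat m * r"
    using assms by (metis gaussian_congE)
  then show ?thesis using assms[THEN gaussian_congD]
    by (intro gaussian_congI[of _ "q + r"]) (auto simp: algebra_simps)
qed

lemma gaussian_cong_trans [trans]:
  assumes "gaussian_cong z w m" "gaussian_cong w v m"
  shows "gaussian_cong z v m"
proof -
  obtain q r where "q \<in> gaussian_ints" "z = w + of_nat m * q"
    "r \<in> gaussian_ints" "w = v + of_nat m * r"
    using assms by (metis gaussian_congE)
  then show ?thesis using assms[THEN gaussian_congD]
    by (intro gaussian_congI[of _ "q + r"]) (auto simp: algebra_simps)
qed

lemma gaussian_cong_mult:
  assumes "gaussian_cong z w m" "gaussian_cong u v m"
  shows "gaussian_cong (z * u) (w * v) m"
proof -
  obtain q r where "q \<in> gaussian_ints" "z = w + of_nat m * q"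
    "r \<in> gaussian_ints" "u = v + of_nat m * r"
    using assms by (metis gaussian_congE)
  then show ?thesis using assms[THEN gaussian_congD]
    by (intro gaussian_congI[of _ "q * v + w * r + of_nat m * q * r"]) (auto simp: algebra_simps)
qed

lemma gaussian_cong_diff:
  assumes "gaussian_cong z w m" "gaussian_cong u v m"
  shows "gaussian_cong (z - u) (w - v) m"
  using gaussian_cong_add[OF assms(1) gaussian_cong_mult[OF gaussian_cong_refl[of "-1"] assms(2)]]
  by simp

lemma gaussian_cong_power: "gaussian_cong z w m \<Longrightarrow> gaussian_cong (z ^ k) (w ^ k) m"
  by (induction k) (auto intro: gaussian_cong_mult)

lemma gaussian_cong_sum:
  "(\<And>x. x \<in> A \<Longrightarrow> gaussian_cong (f x) (g x) m) \<Longrightarrow> gaussian_cong (sum f A) (sum g A) m"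
  by (induction A rule: infinite_finite_induct) (auto intro: gaussian_cong_add)

lemma gaussian_cong_prod:
  "(\<And>x. x \<in> A \<Longrightarrow> gaussian_cong (f x) (g x) m) \<Longrightarrow> gaussian_cong (prod f A) (prod g A) m"
  by (induction A rule: infinite_finite_induct) (auto intro: gaussian_cong_mult)

lemma gaussian_cong_diff_0_iff:
  "z \<in> gaussian_ints \<Longrightarrow> w \<in> gaussian_ints \<Longrightarrow> gaussian_cong (z - w) 0 m \<longleftrightarrow> gaussian_cong z w m"
  by (auto simp: gaussian_cong_def)

lemma gaussian_cong_0_mult:
  "gaussian_cong z 0 m \<Longrightarrow> w \<in> gaussian_ints \<Longrightarrow> gaussian_cong (w * z) 0 m"
  using gaussian_cong_mult[OF gaussian_cong_refl, of w z 0 m] by simp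

lemma gaussian_cong_modulus_0: "q \<in> gaussian_ints \<Longrightarrow> gaussian_cong (of_nat m * q) 0 m"
  by (rule gaussian_congI[of _ q]) auto

lemma gaussian_cong_dvd_modulus:
  assumes "gaussian_cong z w m" "d dvd m"
  shows "gaussian_cong z w d"
proof -
  obtain c where "m = d * c" using assms(2) by blast
  moreover obtain q where "q \<in> gaussian_ints" "z = w + of_nat m * q"
    using assms(1) by (rule gaussian_congE)
  ultimately show ?thesis using gaussian_congD[OF assms(1)]
    by (intro gaussian_congI[of _ "of_nat c * q"]) (auto simp: mult.assoc)
qed

lemma gaussian_cong_0_iff:
  "gaussian_cong (of_int x + of_int y * \<i>) 0 m \<longleftrightarrow> int m dvd x \<and> int m dvd y"
proof
  assume "gaussian_cong (of_int x + of_int y * \<i>) 0 m"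
  then obtain q where "q \<in> gaussian_ints" "of_int x + of_int y * \<i> = of_nat m * q"
    by (auto elim: gaussian_congE)
  then obtain u v where "of_int x + of_int y * \<i> = of_nat m * (of_int u + of_int v * \<i>)"
    by (metis gaussian_intsE)
  then have "complex_of_int x = complex_of_int (int m * u)" "complex_of_int y = complex_of_int (int m * v)"
    by (auto simp: complex_eq_iff)
  then have "x = int m * u" "y = int m * v" by (metis of_int_eq_iff)+
  then show "int m dvd x \<and> int m dvd y" by simp
next
  assume "int m dvd x \<and> int m dvd y"
  then obtain u v where "x = int m * u" "y = int m * v" by (meson dvdE)
  then show "gaussian_cong (of_int x + of_int y * \<i>) 0 m"
    by (intro gaussian_congI[of _ "of_int u + of_int v * \<i>"]) (auto simp: algebra_simps)
qed

lemma gaussian_cong_of_nat_0_iff: "gaussian_cong (of_nat c) 0 m \<longleftrightarrow> m dvd c"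
  using gaussian_cong_0_iff[of "int c" 0 m] by simp

text \<open>Congruence to zero modulo a rational integer is divisibility of both coordinates, which reduces this and the
next lemma to statements about rational integers.\<close>

lemma gaussian_cong_cancel_coprime:
  assumes "gaussian_cong (of_nat c * z) 0 m" "coprime c m" "z \<in> gaussian_ints"
  shows "gaussian_cong z 0 m"
proof -
  obtain x y where z: "z = of_int x + of_int y * \<i>" using assms(3) by (rule gaussian_intsE)
  have "of_nat c * z = of_int (int c * x) + of_int (int c * y) * \<i>"
    by (simp add: z algebra_simps)
  then have "int m dvd int c * x \<and> int m dvd int c * y"
    using assms(1) gaussian_cong_0_iff by metis
  moreover have "coprime (int m) (int c)" using assms(2) by (simp add: coprime_commute)
  ultimately show ?thesis unfolding z gaussian_cong_0_iff by (simp add: coprime_dvd_mult_right_iff)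
qed

lemma gaussian_cong_0_by_prime_powers:
  assumes "n > 0" "z \<in> gaussian_ints"
    and "\<And>p. prime p \<Longrightarrow> p dvd n \<Longrightarrow> gaussian_cong z 0 (p ^ multiplicity p n)"
  shows "gaussian_cong z 0 n"
proof -
  obtain x y where z: "z = of_int x + of_int y * \<i>" using assms(2) by (rule gaussian_intsE)
  have *: "n dvd nat \<bar>w\<bar>" if "\<And>p. prime p \<Longrightarrow> p dvd n \<Longrightarrow> int (p ^ multiplicity p n) dvd w" for w
  proof (cases "w = 0")
    case False
    then have w0: "nat \<bar>w\<bar> \<noteq> 0" by simp
    show ?thesis
    proof (rule multiplicity_le_imp_dvd)
      fix p :: nat assume p: "prime p"
      show "multiplicity p n \<le> multiplicity p (nat \<bar>w\<bar>)"
      proof (cases "p dvd n")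
        case True
        then have "p ^ multiplicity p n dvd nat \<bar>w\<bar>" using that p by (simp add: nat_abs_dvd_iff)
        then show ?thesis using w0 p by (intro multiplicity_geI) auto
      qed (simp add: not_dvd_imp_multiplicity_0)
    qed (use assms(1) in simp)
  qed simp
  have "int (p ^ multiplicity p n) dvd x \<and> int (p ^ multiplicity p n) dvd y"
    if "prime p" "p dvd n" for p
    using assms(3)[OF that] unfolding z gaussian_cong_0_iff .
  then have "n dvd nat \<bar>x\<bar>" "n dvd nat \<bar>y\<bar>" using * by blast+
  then show ?thesis unfolding z gaussian_cong_0_iff by (simp add: dvd_nat_abs_iff)
qed

section \<open>Powers modulo prime powers\<close>

text \<open>In \<open>z\<^sup>p - w\<^sup>p = (z - w) (z\<^sup>p\<^sup>-\<^sup>1 + \<dots> + w\<^sup>p\<^sup>-\<^sup>1)\<close> the \<open>p\<close> terms of the second factor are all congruent to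
\<open>w\<^sup>p\<^sup>-\<^sup>1\<close> modulo \<open>p\<close>, so that factor contributes one more \<open>p\<close>.\<close>

lemma gaussian_cong_power_prime_step:
  assumes "gaussian_cong z w m" "p dvd m"
  shows "gaussian_cong (z ^ p) (w ^ p) (m * p)"
proof -
  have zw: "z \<in> gaussian_ints" "w \<in> gaussian_ints" using gaussian_congD[OF assms(1)] by auto
  define s where "s = (\<Sum>i<p. w ^ (p - Suc i) * z ^ i)"
  have "gaussian_cong s (\<Sum>i<p. w ^ (p - Suc i) * w ^ i) p"
    unfolding s_def
    by (intro gaussian_cong_sum gaussian_cong_mult gaussian_cong_power
        gaussian_cong_dvd_modulus[OF assms] gaussian_cong_refl gaussian_ints_power zw)
  also have "(\<Sum>i<p. w ^ (p - Suc i) * w ^ i) = of_nat p * w ^ (p - 1)"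
    by (simp flip: power_add)
  also have "gaussian_cong \<dots> 0 p" by (intro gaussian_cong_modulus_0 gaussian_ints_power zw)
  finally obtain r where r: "r \<in> gaussian_ints" "s = of_nat p * r" by (auto elim: gaussian_congE)
  obtain q where q: "q \<in> gaussian_ints" "z = w + of_nat m * q"
    using assms(1) by (rule gaussian_congE)
  have "z ^ p - w ^ p = (z - w) * s" unfolding s_def by (rule power_diff_sumr2)
  also have "\<dots> = of_nat (m * p) * (q * r)" by (simp add: q r)
  finally show ?thesis using q r zw
    by (intro gaussian_congI[of _ "q * r"]) (auto simp: algebra_simps)
qed

text \<open>Each of the \<open>e - 1\<close> factors \<open>p\<close> used up in the exponent improves the modulus by one power of \<open>p\<close>. With
\<open>n\<close> both exponent and modulus there are always enough of them.\<close>

lemma gaussian_cong_power_lift: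
  assumes "gaussian_cong z w p" "p ^ e dvd n" "e \<ge> 1"
  shows "gaussian_cong (z ^ n) (w ^ n) (p ^ e)"
proof -
  have step: "gaussian_cong (z ^ p ^ j) (w ^ p ^ j) (p ^ Suc j)" for j
  proof (induction j)
    case (Suc j)
    then show ?case using gaussian_cong_power_prime_step[OF Suc]
      by (simp add: power_mult[symmetric] mult.commute)
  qed (use assms(1) in simp)
  obtain k where "n = p ^ (e - 1) * k"
    using assms(2) by (meson dvd_def dvd_trans le_imp_power_dvd diff_le_self)
  then show ?thesis using gaussian_cong_power[OF step[of "e - 1"], of k] assms(3)
    by (simp add: power_mult)
qed

lemma gaussian_cong_periodic_sum:
  assumes "\<And>a. gaussian_cong (f (a + p)) (f a) m" "\<And>a. f a \<in> gaussian_ints"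
  shows "gaussian_cong (\<Sum>a=1..p * t. f a) (of_nat t * (\<Sum>a=1..p. f a)) m"
proof (induction t)
  case (Suc t)
  have per: "gaussian_cong (f (a + p * t)) (f a) m" for a
  proof (induction t)
    case (Suc t)
    have "gaussian_cong (f (a + p * t + p)) (f (a + p * t)) m" by (rule assms)
    also note Suc
    finally show ?case by (simp add: algebra_simps)
  qed (use assms(2) in simp)
  have "(\<Sum>a=1..p * Suc t. f a) = (\<Sum>a=1..p * t. f a) + (\<Sum>a=p * t + 1..p * t + p. f a)"
    by (subst sum.ub_add_nat[symmetric]) (auto simp: add.commute)
  also have "(\<Sum>a=p * t + 1..p * t + p. f a) = (\<Sum>a=1..p. f (a + p * t))"
    by (subst sum.shift_bounds_cl_nat_ivl[symmetric]) (simp add: add.commute)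
  also have "gaussian_cong ((\<Sum>a=1..p * t. f a) + \<dots>)
      (of_nat t * (\<Sum>a=1..p. f a) + (\<Sum>a=1..p. f a)) m"
    by (intro gaussian_cong_add Suc gaussian_cong_sum per)
  finally show ?case by (simp add: algebra_simps)
qed simp

lemma gaussian_power_sum_in_gaussian_ints [simp]: "gaussian_power_sum k n \<in> gaussian_ints"
  unfolding gaussian_power_sum_def by auto

text \<open>Both coordinates of the base matter only modulo \<open>p\<close>, so the square of side \<open>p t\<close> splits into \<open>t\<^sup>2\<close>
equivalent squares of side \<open>p\<close>.\<close>

lemma gaussian_power_sum_reduce:
  assumes "p ^ e dvd p * t" "e \<ge> 1"
  shows "gaussian_cong (gaussian_power_sum (p * t) (p * t))
           ((of_nat t)\<^sup>2 * gaussian_power_sum (p * t) p) (p ^ e)"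
proof -
  define f where "f a b = (of_nat a + of_nat b * \<i>) ^ (p * t)" for a b :: nat
  have G: "f a b \<in> gaussian_ints" for a b by (auto simp: f_def)
  have lift: "gaussian_cong (f a b) (f a' b') (p ^ e)"
    if "gaussian_cong (of_nat a + of_nat b * \<i>) (of_nat a' + of_nat b' * \<i>) p" for a b a' b'
    unfolding f_def using that assms by (rule gaussian_cong_power_lift)
  have per1: "gaussian_cong (f (a + p) b) (f a b) (p ^ e)" for a b
    by (intro lift gaussian_congI[of _ 1]) auto
  have per2: "gaussian_cong (f a (b + p)) (f a b) (p ^ e)" for a b
    by (intro lift gaussian_congI[of _ \<i>]) (auto simp: algebra_simps)
  have "gaussian_cong (\<Sum>a=1..p*t. \<Sum>b=1..p*t. f a b)
      (of_nat t * (\<Sum>a=1..p. \<Sum>b=1..p*t. f a b)) (p ^ e)"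
    by (intro gaussian_cong_periodic_sum gaussian_cong_sum per1 gaussian_ints_sum G)
  also have "gaussian_cong (of_nat t * (\<Sum>a=1..p. \<Sum>b=1..p*t. f a b))
      (of_nat t * (\<Sum>a=1..p. of_nat t * (\<Sum>b=1..p. f a b))) (p ^ e)"
    by (intro gaussian_cong_mult gaussian_cong_sum gaussian_cong_periodic_sum per2 G) auto
  finally show ?thesis
    by (simp add: gaussian_power_sum_def f_def sum_distrib_left power2_eq_square mult.assoc)
qed

section \<open>Residue systems modulo a rational integer\<close>

text \<open>The coordinates run from \<open>1\<close> to \<open>p\<close>, as in \<^const>\<open>gaussian_power_sum\<close>; the class of zero is therefore
represented by \<open>p + p \<i>\<close>.\<close>

definition residue_box :: "nat \<Rightarrow> complex set" where
  "residue_box p = (\<lambda>(a, b). of_nat a + of_nat b * \<i>) ` ({1..p} \<times> {1..p})"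

lemma residue_box_inj: "inj_on (\<lambda>(a, b). of_nat a + of_nat b * \<i>) A"
  by (auto simp: inj_on_def complex_eq_iff)

lemma finite_residue_box [simp]: "finite (residue_box p)"
  by (simp add: residue_box_def)

lemma card_residue_box: "card (residue_box p) = p\<^sup>2"
  by (simp add: residue_box_def card_image[OF residue_box_inj] power2_eq_square)

lemma residue_box_gaussian: "z \<in> residue_box p \<Longrightarrow> z \<in> gaussian_ints"
  by (auto simp: residue_box_def)

lemma gaussian_power_sum_residue_box: "gaussian_power_sum k p = (\<Sum>z\<in>residue_box p. z ^ k)"
  unfolding residue_box_def gaussian_power_sum_def sum.reindex[OF residue_box_inj]
  by (simp add: sum.cartesian_product o_def case_prod_unfold)

lemma residue_box_cong_eq:
  assumes "z \<in> residue_box p" "w \<in> residue_box p" "gaussian_cong z w p"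
  shows "z = w"
proof -
  obtain a b c d where z: "z = of_nat a + of_nat b * \<i>" and w: "w = of_nat c + of_nat d * \<i>"
    and r: "a \<in> {1..p}" "b \<in> {1..p}" "c \<in> {1..p}" "d \<in> {1..p}"
    using assms(1,2) by (auto simp: residue_box_def)
  have "gaussian_cong (z - w) 0 p"
    using assms residue_box_gaussian gaussian_cong_diff_0_iff by blast
  moreover have "z - w = of_int (int a - int c) + of_int (int b - int d) * \<i>"
    by (simp add: z w algebra_simps)
  ultimately have "int p dvd int a - int c" "int p dvd int b - int d"
    by (simp_all only: gaussian_cong_0_iff)
  moreover have "\<bar>int a - int c\<bar> < int p" "\<bar>int b - int d\<bar> < int p" using r by auto
  moreover have "x = 0" if "int p dvd x" "\<bar>x\<bar> < int p" for x
    using dvd_imp_le_int[of x "int p"] that by fastforce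
  ultimately have "int a - int c = 0" "int b - int d = 0" by blast+
  then show ?thesis by (simp add: z w)
qed

lemma residue_box_rep:
  assumes "z \<in> gaussian_ints" "p > 0"
  shows "\<exists>r\<in>residue_box p. gaussian_cong r z p"
proof -
  obtain x y where z: "z = of_int x + of_int y * \<i>" using assms(1) by (rule gaussian_intsE)
  have *: "\<exists>a\<in>{1..p}. \<exists>c. int a = x + int p * c" for x
  proof (intro bexI exI)
    have "(x - 1) mod int p + 1 = x - int p * ((x - 1) div int p)"
      using mult_div_mod_eq[of "int p" "x - 1"] by linarith
    moreover have "0 \<le> (x - 1) mod int p" "(x - 1) mod int p < int p" using assms(2) by auto
    ultimately show "nat ((x - 1) mod int p + 1) \<in> {1..p}"
      "int (nat ((x - 1) mod int p + 1)) = x + int p * (- ((x - 1) div int p))"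
      by auto
  qed
  obtain a c b d where ab: "a \<in> {1..p}" "int a = x + int p * c" "b \<in> {1..p}" "int b = y + int p * d"
    using *[of x] *[of y] by blast
  have "complex_of_int (int a) = of_int (x + int p * c)" "complex_of_int (int b) = of_int (y + int p * d)"
    unfolding ab by auto
  then have "of_nat a + of_nat b * \<i> = z + of_nat p * (of_int c + of_int d * \<i>)"
    by (simp add: z algebra_simps)
  then have "gaussian_cong (of_nat a + of_nat b * \<i>) z p"
    by (intro gaussian_congI[of _ "of_int c + of_int d * \<i>"]) (use assms in auto)
  moreover have "of_nat a + of_nat b * \<i> \<in> residue_box p"
    unfolding residue_box_def using ab by (intro image_eqI[of _ _ "(a, b)"]) auto
  ultimately show ?thesis by blast
qed

text \<open>Changes of variable: a map that is injective on residue classes permutes them, and composing it with the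
choice of representatives gives an honest permutation of the box.\<close>

lemma residue_box_bij:
  assumes "p > 0" "\<And>z. z \<in> residue_box p \<Longrightarrow> g z \<in> gaussian_ints"
    and inj: "\<And>z w. \<lbrakk>z \<in> residue_box p; w \<in> residue_box p; gaussian_cong (g z) (g w) p\<rbrakk> \<Longrightarrow> z = w"
  obtains h where "bij_betw h (residue_box p) (residue_box p)"
    "\<And>z. z \<in> residue_box p \<Longrightarrow> gaussian_cong (h z) (g z) p"
proof -
  obtain h where h: "\<And>z. z \<in> residue_box p \<Longrightarrow> h z \<in> residue_box p \<and> gaussian_cong (h z) (g z) p"
    using residue_box_rep[OF assms(2) assms(1)] by metis
  have "inj_on h (residue_box p)"
  proof (rule inj_onI)
    fix z w assume zw: "z \<in> residue_box p" "w \<in> residue_box p" "h z = h w"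
    then have "gaussian_cong (g z) (g w) p"
      using h by (metis gaussian_cong_sym gaussian_cong_trans)
    with zw show "z = w" by (intro inj)
  qed
  moreover have "h ` residue_box p = residue_box p"
    using calculation h by (intro card_subset_eq) (auto simp: card_image)
  ultimately show ?thesis using h that by (simp add: bij_betw_def)
qed

section \<open>Power sums modulo split primes\<close>

text \<open>Moving a window of length \<open>p\<close> by one step exchanges a term for another one at distance \<open>p\<close>.\<close>

lemma periodic_shift_sum:
  fixes f :: "nat \<Rightarrow> complex"
  assumes "\<And>a. gaussian_cong (f (a + p)) (f a) m" "\<And>a. f a \<in> gaussian_ints" "p \<ge> 1"
  shows "gaussian_cong (\<Sum>a=1..p. f (a + c)) (\<Sum>a=1..p. f a) m"
proof (induction c)
  case (Suc c)
  have "(\<Sum>a=1..p. f (a + Suc c)) = (\<Sum>a=Suc 1..Suc p. f (a + c))"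
    by (subst sum.shift_bounds_cl_Suc_ivl) simp
  also have "\<dots> = (\<Sum>a=1..p. f (a + c)) - f (1 + c) + f (1 + c + p)"
    using assms(3) sum.atLeast_Suc_atMost[of 1 p "\<lambda>a. f (a + c)"] by (simp add: add_ac)
  also have "gaussian_cong \<dots> ((\<Sum>a=1..p. f (a + c)) - f (1 + c) + f (1 + c)) m"
    by (intro gaussian_cong_add gaussian_cong_refl gaussian_ints_diff gaussian_ints_sum assms(1,2))
  also have "(\<Sum>a=1..p. f (a + c)) - f (1 + c) + f (1 + c) = (\<Sum>a=1..p. f (a + c))" by simp
  also note Suc
  finally show ?case .
qed (use assms in auto)

text \<open>If \<open>c\<^sup>2 \<equiv> -1\<close>, then \<open>(c + \<i>) (\<i> - c) = -(c\<^sup>2 + 1) \<equiv> 0\<close>: after multiplication by \<open>c + \<i>\<close> the unit \<open>\<i>\<close> can be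
replaced by the rational integer \<open>c\<close>, and the base \<open>a + b \<i>\<close> by \<open>a + b c\<close>. The sum over \<open>a\<close> then runs
through a full residue system for every \<open>b\<close>, and the sum over \<open>b\<close> produces the factor \<open>p\<close>. This avoids
splitting the ring into a product of two fields.\<close>

lemma zero_divisor_annihilates_power_sum:
  assumes "p dvd c\<^sup>2 + 1" "p \<ge> 1"
  shows "gaussian_cong ((of_nat c + \<i>) * gaussian_power_sum k p) 0 p"
proof -
  have step: "gaussian_cong ((of_nat c + \<i>) * (of_nat a + of_nat b * \<i>) ^ k)
      ((of_nat c + \<i>) * of_nat (a + b * c) ^ k) p" for a b
  proof (induction k)
    case (Suc k)
    obtain q where q: "c\<^sup>2 + 1 = p * q" using assms(1) by blast
    have "(of_nat c + \<i>) * (of_nat a + of_nat b * \<i>)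
        = (of_nat c + \<i>) * of_nat (a + b * c) - of_nat b * of_nat (c\<^sup>2 + 1)"
      by (simp add: algebra_simps power2_eq_square)
    also have "\<dots> = (of_nat c + \<i>) * of_nat (a + b * c) + of_nat p * of_int (- int (b * q))"
      unfolding q by simp
    finally have base: "gaussian_cong ((of_nat c + \<i>) * (of_nat a + of_nat b * \<i>))
        ((of_nat c + \<i>) * of_nat (a + b * c)) p"
      by (intro gaussian_congI[of _ "of_int (- int (b * q))"]) auto
    have "gaussian_cong (((of_nat c + \<i>) * (of_nat a + of_nat b * \<i>) ^ k) * (of_nat a + of_nat b * \<i>))
      (((of_nat c + \<i>) * of_nat (a + b * c) ^ k) * (of_nat a + of_nat b * \<i>)) p"
      by (rule gaussian_cong_mult[OF Suc]) auto
    also have "((of_nat c + \<i>) * of_nat (a + b * c) ^ k) * (of_nat a + of_nat b * \<i>)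
        = of_nat (a + b * c) ^ k * ((of_nat c + \<i>) * (of_nat a + of_nat b * \<i>))"
      by (simp only: mult_ac)
    also have "gaussian_cong \<dots> (of_nat (a + b * c) ^ k * ((of_nat c + \<i>) * of_nat (a + b * c))) p"
      by (intro gaussian_cong_mult base gaussian_cong_refl) auto
    finally show ?case by (simp add: mult_ac)
  qed auto
  have shift: "gaussian_cong (\<Sum>a=1..p. of_nat (a + b * c) ^ k) (\<Sum>a=1..p. of_nat a ^ k) p" for b
  proof (rule periodic_shift_sum)
    show "gaussian_cong (of_nat (a + p) ^ k) (of_nat a ^ k) p" for a
      by (intro gaussian_cong_power gaussian_congI[of _ 1]) auto
  qed (use assms in auto)
  have "(of_nat c + \<i>) * gaussian_power_sum k p =
      (\<Sum>a=1..p. \<Sum>b=1..p. (of_nat c + \<i>) * (of_nat a + of_nat b * \<i>) ^ k)"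
    by (simp add: gaussian_power_sum_def sum_distrib_left)
  also have "gaussian_cong \<dots> (\<Sum>a=1..p. \<Sum>b=1..p. (of_nat c + \<i>) * of_nat (a + b * c) ^ k) p"
    by (intro gaussian_cong_sum step)
  also have "(\<Sum>a=1..p. \<Sum>b=1..p. (of_nat c + \<i>) * of_nat (a + b * c) ^ k)
      = (\<Sum>b=1..p. (of_nat c + \<i>) * (\<Sum>a=1..p. of_nat (a + b * c) ^ k))"
    by (subst sum.swap) (simp only: sum_distrib_left)
  also have "gaussian_cong \<dots> (\<Sum>b=1..p. (of_nat c + \<i>) * (\<Sum>a=1..p. of_nat a ^ k)) p"
    by (intro gaussian_cong_sum gaussian_cong_mult shift) auto
  also have "(\<Sum>b=1..p. (of_nat c + \<i>) * (\<Sum>a=1..p. of_nat a ^ k))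
      = of_nat p * ((of_nat c + \<i>) * (\<Sum>a=1..p. of_nat a ^ k))" by simp
  also have "gaussian_cong \<dots> 0 p" by (intro gaussian_cong_modulus_0) auto
  finally show ?thesis .
qed

text \<open>Euler's criterion, as \<open>(p - 1) / 2\<close> is even.\<close>

lemma minus_one_square_mod_prime:
  assumes "prime p" "p mod 4 = (1::nat)"
  obtains c where "p dvd c\<^sup>2 + 1"
proof -
  have p2: "p > 2" using assms prime_gt_1_nat[of p] by (cases "p = 2") auto
  have "even ((p - 1) div 2)" using assms(2) by presburger
  then have "[Legendre (-1) (int p) = 1] (mod int p)"
    using euler_criterion[OF assms(1) p2, of "-1"] by simp
  moreover have "\<not> [-1 = 1] (mod int p)"
  proof
    assume "[-1 = 1] (mod int p)"
    then have "int p dvd 2" by (simp add: cong_iff_dvd_diff)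
    then show False using p2 zdvd_imp_le[of "int p" 2] by simp
  qed
  moreover have "\<not> [0 = 1] (mod int p)"
    using p2 zdvd_imp_le[of "int p" 1] by (auto simp: cong_iff_dvd_diff)
  ultimately have "QuadRes (int p) (-1)" by (auto simp: Legendre_def split: if_splits)
  then obtain y where "[y\<^sup>2 = -1] (mod int p)" by (auto simp: QuadRes_def)
  then have "int p dvd int ((nat \<bar>y\<bar>)\<^sup>2 + 1)"
    by (simp add: cong_iff_dvd_diff add.commute)
  then show ?thesis using that by (simp only: int_dvd_int_iff)
qed

text \<open>The power sum is annihilated by \<open>c + \<i>\<close> for both square roots \<open>c\<close> of \<open>-1\<close>, hence by the difference \<open>2 c\<close>,
which is invertible modulo \<open>p\<close>.\<close>

lemma power_sum_split_prime:
  assumes "prime p" "p mod 4 = (1::nat)"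
  shows "gaussian_cong (gaussian_power_sum k p) 0 p"
proof -
  obtain c where c: "p dvd c\<^sup>2 + 1" using minus_one_square_mod_prime[OF assms] .
  have p1: "p \<ge> 1" using assms(1) prime_ge_1_nat by blast
  let ?G = "gaussian_power_sum k p"
  \<comment> \<open>\<open>c * (p - 1)\<close> is a natural number representing the other square root \<open>-c\<close>.\<close>
  have "p dvd (c * (p - 1))\<^sup>2 + 1"
  proof -
    have "[int (c * (p - 1)) = - int c] (mod int p)"
      using p1 by (simp add: cong_iff_dvd_diff of_nat_diff algebra_simps)
    then have "[(int (c * (p - 1)))\<^sup>2 + 1 = (- int c)\<^sup>2 + 1] (mod int p)"
      by (intro cong_add cong_pow) auto
    then have "int p dvd (int (c * (p - 1)))\<^sup>2 + 1 \<longleftrightarrow> int p dvd (- int c)\<^sup>2 + 1"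
      by (rule cong_dvd_iff)
    then have "int p dvd int ((c * (p - 1))\<^sup>2 + 1) \<longleftrightarrow> int p dvd int (c\<^sup>2 + 1)"
      by (simp only: of_nat_add of_nat_power of_nat_1 power2_minus)
    then show ?thesis using c by (simp only: int_dvd_int_iff)
  qed
  from gaussian_cong_diff[OF zero_divisor_annihilates_power_sum[OF c p1]
      zero_divisor_annihilates_power_sum[OF this p1]]
  have "gaussian_cong ((of_nat c + \<i>) * ?G - (of_nat (c * (p - 1)) + \<i>) * ?G) 0 p" by simp
  from gaussian_cong_add[OF this gaussian_cong_modulus_0[of "of_nat c * ?G" p]]
  have "gaussian_cong (of_nat (2 * c) * ?G) 0 p"
    using p1 by (simp add: of_nat_diff algebra_simps)
  moreover have "coprime (2 * c) p"
  proof -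
    have "\<not> p dvd c"
    proof
      assume "p dvd c"
      then have "p dvd c\<^sup>2" by (simp add: power2_eq_square)
      then have "p dvd 1" using c dvd_add_right_iff by blast
      then show False using assms(1) by simp
    qed
    moreover have "\<not> p dvd 2" using assms by (auto dest!: primes_dvd_imp_eq[OF _ two_is_prime_nat])
    ultimately show ?thesis using assms(1)
      by (metis coprime_commute coprime_mult_right_iff prime_imp_coprime)
  qed
  ultimately show ?thesis by (rule gaussian_cong_cancel_coprime) simp
qed

section \<open>Power sums modulo inert primes\<close>

text \<open>If \<open>x\<^sup>2 \<equiv> -y\<^sup>2\<close> with \<open>y\<close> invertible, raising to the odd power \<open>(p - 1) / 2\<close> and applying Fermat's theorem
gives \<open>1 \<equiv> -1\<close>.\<close>

lemma prime_dvd_sum_of_squares: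
  fixes x y :: int
  assumes "prime p" "p mod 4 = (3::nat)" "int p dvd x\<^sup>2 + y\<^sup>2"
  shows "int p dvd x \<and> int p dvd y"
proof -
  have ip: "prime (int p)" using assms(1) by simp
  have p2: "p > 2" using assms prime_gt_1_nat[of p] by (cases "p = 2") auto
  define h where "h = (p - 1) div 2"
  have h: "odd h" "2 * h = p - 1" using assms(2) unfolding h_def by presburger+
  have fermat: "[w ^ (p - 1) = 1] (mod int p)" if "\<not> int p dvd w" for w
  proof -
    have "\<not> p dvd nat \<bar>w\<bar>" using that by (simp add: dvd_nat_abs_iff)
    then have "[nat \<bar>w\<bar> ^ (p - 1) = 1] (mod p)" by (rule fermat_theorem[OF assms(1)])
    then have "[int (nat \<bar>w\<bar> ^ (p - 1)) = int 1] (mod int p)" by (simp only: cong_int_iff)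
    moreover have "\<bar>w\<bar> ^ (p - 1) = w ^ (p - 1)" using h(2) by (metis power_even_abs dvd_triv_left)
    ultimately show ?thesis by simp
  qed
  have y: "int p dvd y"
  proof (rule ccontr)
    assume ny: "\<not> int p dvd y"
    have nx: "\<not> int p dvd x"
    proof
      assume "int p dvd x"
      then have "int p dvd y\<^sup>2" using assms(3) by (simp add: dvd_add_right_iff power2_eq_square)
      with ny show False using ip prime_dvd_power by blast
    qed
    have "[x\<^sup>2 = - (y\<^sup>2)] (mod int p)" using assms(3) by (simp add: cong_iff_dvd_diff)
    then have "[(x\<^sup>2) ^ h = (- (y\<^sup>2)) ^ h] (mod int p)" by (rule cong_pow)
    then have "[x ^ (p - 1) = - (y ^ (p - 1))] (mod int p)"
      using h by (simp add: power_mult[symmetric])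
    moreover have "[- (y ^ (p - 1)) = - 1] (mod int p)"
      using fermat[OF ny] by (simp add: cong_minus_minus_iff)
    ultimately have "[1 = -1] (mod int p)"
      using fermat[OF nx] by (meson cong_sym cong_trans)
    then have "int p dvd 2" by (simp add: cong_iff_dvd_diff)
    then show False using p2 zdvd_imp_le[of "int p" 2] by simp
  qed
  then have "int p dvd x\<^sup>2" using assms(3) by (simp add: dvd_add_left_iff power2_eq_square)
  with y show ?thesis using ip prime_dvd_power by blast
qed

text \<open>By the previous lemma the norm \<open>x\<^sup>2 + y\<^sup>2\<close> of a nonzero residue is invertible modulo \<open>p\<close>, so multiplying with
the conjugate recovers the other factor.\<close>

lemma inert_prime_mult:
  assumes p: "prime p" "p mod 4 = (3::nat)"
    and zw: "z \<in> gaussian_ints" "w \<in> gaussian_ints" "gaussian_cong (z * w) 0 p"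
  shows "gaussian_cong z 0 p \<or> gaussian_cong w 0 p"
proof -
  obtain x y u v where z: "z = of_int x + of_int y * \<i>" and w: "w = of_int u + of_int v * \<i>"
    using zw(1,2) by (metis gaussian_intsE)
  have "z * w = of_int (x * u - y * v) + of_int (x * v + y * u) * \<i>"
    by (simp add: z w algebra_simps)
  then have d: "int p dvd x * u - y * v" "int p dvd x * v + y * u"
    using zw(3) gaussian_cong_0_iff by metis+
  have "x * (x * u - y * v) + y * (x * v + y * u) = (x\<^sup>2 + y\<^sup>2) * u"
    "x * (x * v + y * u) - y * (x * u - y * v) = (x\<^sup>2 + y\<^sup>2) * v"
    by (simp_all add: algebra_simps power2_eq_square)
  then have "int p dvd (x\<^sup>2 + y\<^sup>2) * u" "int p dvd (x\<^sup>2 + y\<^sup>2) * v"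
    using d by (metis dvd_add dvd_diff dvd_mult)+
  moreover have "prime (int p)" using p(1) by simp
  ultimately have "int p dvd x\<^sup>2 + y\<^sup>2 \<or> (int p dvd u \<and> int p dvd v)"
    by (metis prime_dvd_mult_iff)
  then show ?thesis
    using prime_dvd_sum_of_squares[OF p] unfolding z w gaussian_cong_0_iff by blast
qed

lemma not_gaussian_cong_1_0: "prime p \<Longrightarrow> \<not> gaussian_cong 1 0 p"
  using gaussian_cong_of_nat_0_iff[of 1 p] prime_gt_1_nat[of p] by simp

lemma synthetic_div_gaussian_coeffs:
  assumes "\<And>i. Polynomial.coeff f i \<in> gaussian_ints" "a \<in> gaussian_ints"
  shows "poly f a \<in> gaussian_ints \<and> (\<forall>i. Polynomial.coeff (synthetic_div f a) i \<in> gaussian_ints)"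
  using assms(1)
proof (induction f)
  case (pCons c f)
  have "Polynomial.coeff f i \<in> gaussian_ints" for i using pCons.prems[of "Suc i"] by simp
  moreover have "c \<in> gaussian_ints" using pCons.prems[of 0] by simp
  ultimately show ?case using pCons.IH assms(2) by (auto simp: coeff_pCons split: nat.split)
qed simp

text \<open>Lagrange's bound on the number of roots. Division by \<open>X - a\<close> keeps the polynomial monic with Gaussian
coefficients, so the usual induction on the degree works modulo \<open>p\<close> without constructing the residue
field.\<close>

lemma monic_poly_roots_mod_inert_prime:
  assumes p: "prime p" "p mod 4 = (3::nat)"
    and "finite A" "A \<subseteq> gaussian_ints"
    and "\<And>a b. \<lbrakk>a \<in> A; b \<in> A; gaussian_cong a b p\<rbrakk> \<Longrightarrow> a = b"
    and "\<And>i. Polynomial.coeff f i \<in> gaussian_ints" "lead_coeff f = 1"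
    and "\<And>a. a \<in> A \<Longrightarrow> gaussian_cong (poly f a) 0 p"
  shows "card A \<le> degree f"
  using assms(3-)
proof (induction "degree f" arbitrary: f A)
  case 0
  then have "f = 1" by (metis degree_eq_zeroE lead_coeff_pCons(2) one_pCons pCons_eq_0_iff coeff_pCons_0)
  then have "A = {}" using 0(7) not_gaussian_cong_1_0[OF p(1)] by auto
  then show ?case by simp
next
  case (Suc d)
  show ?case
  proof (cases "A = {}")
    case False
    then obtain a where a: "a \<in> A" by blast
    define g where "g = synthetic_div f a"
    have aG: "a \<in> gaussian_ints" using a Suc.prems by auto
    have gG: "Polynomial.coeff g i \<in> gaussian_ints" for i
      using synthetic_div_gaussian_coeffs[OF Suc.prems(4) aG] by (simp add: g_def)
    have deg: "degree g = d" using Suc.hyps(2) by (simp add: g_def degree_synthetic_div)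
    have f: "f = [:-a, 1:] * g + [:poly f a:]" 
      unfolding g_def by (rule synthetic_div_correct'[symmetric])
    have "Polynomial.coeff f (Suc d) = Polynomial.coeff g d"
      using deg by (subst f) (simp add: coeff_eq_0)
    then have lead: "lead_coeff g = 1" using Suc.prems(5) Suc.hyps(2) deg by simp
    have "card (A - {a}) \<le> degree g"
    proof (rule Suc.hyps(1))
      fix b assume b: "b \<in> A - {a}"
      have bG: "b \<in> gaussian_ints" using b Suc.prems by auto
      have gb: "poly g b \<in> gaussian_ints" using synthetic_div_gaussian_coeffs[OF gG bG] by simp
      have "poly f b - poly f a = (b - a) * poly g b"
        by (subst (1) f) (simp add: algebra_simps)
      moreover have "gaussian_cong (poly f b - poly f a) 0 p"
        using gaussian_cong_diff[OF Suc.prems(6)[of b] Suc.prems(6)[of a]] a b by simp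
      moreover have "\<not> gaussian_cong (b - a) 0 p"
        using Suc.prems(3)[of b a] a b bG aG by (auto simp: gaussian_cong_diff_0_iff)
      ultimately show "gaussian_cong (poly g b) 0 p"
        using inert_prime_mult[OF p _ gb, of "b - a"] aG bG by auto
    qed (use Suc.prems deg lead gG in auto)
    then show ?thesis using a Suc.prems(1) Suc.hyps(2) deg by (simp add: card_Diff_singleton)
  qed simp
qed

context
  fixes p :: nat
  assumes p: "prime p" "p mod 4 = 3"
begin

lemma inert_prime_pos: "p > 0" using p(1) prime_gt_0_nat by blast

lemma residue_box_zero: "z \<in> residue_box p \<Longrightarrow> gaussian_cong z 0 p \<longleftrightarrow> z = of_nat p + of_nat p * \<i>"
proof -
  assume z: "z \<in> residue_box p"
  have "gaussian_cong (of_nat p + of_nat p * \<i>) 0 p"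
    by (intro gaussian_congI[of _ "1 + \<i>"]) (auto simp: algebra_simps)
  moreover have "of_nat p + of_nat p * \<i> \<in> residue_box p"
    unfolding residue_box_def using inert_prime_pos by (intro image_eqI[of _ _ "(p, p)"]) auto
  ultimately show ?thesis
    using residue_box_cong_eq z gaussian_cong_sym gaussian_cong_trans by blast
qed

lemma card_nonzero_residues:
  "card {z \<in> residue_box p. \<not> gaussian_cong z 0 p} = p\<^sup>2 - 1"
proof -
  have "{z \<in> residue_box p. \<not> gaussian_cong z 0 p} = residue_box p - {of_nat p + of_nat p * \<i>}"
    by (auto simp: residue_box_zero)
  moreover have "of_nat p + of_nat p * \<i> \<in> residue_box p"
    unfolding residue_box_def using inert_prime_pos by (intro image_eqI[of _ _ "(p, p)"]) auto
  ultimately show ?thesis by (simp add: card_Diff_singleton card_residue_box)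
qed

lemma mult_permutes_residues:
  assumes "g \<in> gaussian_ints" "\<not> gaussian_cong g 0 p"
  obtains h where "bij_betw h (residue_box p) (residue_box p)"
    "\<And>z. z \<in> residue_box p \<Longrightarrow> gaussian_cong (h z) (g * z) p"
proof (rule residue_box_bij[OF inert_prime_pos, of "\<lambda>z. g * z"])
  fix z w assume zw: "z \<in> residue_box p" "w \<in> residue_box p" "gaussian_cong (g * z) (g * w) p"
  then have G: "z \<in> gaussian_ints" "w \<in> gaussian_ints" using residue_box_gaussian by auto
  have "gaussian_cong (g * (z - w)) 0 p"
    using zw(3) G assms(1) gaussian_cong_diff_0_iff[of "g * z" "g * w" p] by (simp add: algebra_simps)
  then have "gaussian_cong (z - w) 0 p"
    using inert_prime_mult[OF p assms(1), of "z - w"] assms(2) G by auto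
  then show "z = w" using zw G residue_box_cong_eq by (simp add: gaussian_cong_diff_0_iff)
qed (use assms residue_box_gaussian that in auto)

text \<open>Multiplication by \<open>g\<close> permutes the \<open>p\<^sup>2 - 1\<close> nonzero residues; compare the product over all of them before
and after.\<close>

lemma gaussian_fermat:
  assumes "g \<in> gaussian_ints" "\<not> gaussian_cong g 0 p"
  shows "gaussian_cong (g ^ (p\<^sup>2 - 1)) 1 p"
proof -
  obtain h where h: "bij_betw h (residue_box p) (residue_box p)"
    "\<And>z. z \<in> residue_box p \<Longrightarrow> gaussian_cong (h z) (g * z) p"
    using mult_permutes_residues[OF assms] by blast
  define U where "U = {z \<in> residue_box p. \<not> gaussian_cong z 0 p}"
  have UG: "z \<in> gaussian_ints" if "z \<in> U" for z using that residue_box_gaussian by (auto simp: U_def)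
  have fin: "finite U" by (simp add: U_def)
  have hU: "h z \<in> U \<longleftrightarrow> z \<in> U" if "z \<in> residue_box p" for z
  proof -
    have "h z \<in> residue_box p" using h(1) that by (auto simp: bij_betw_def)
    moreover have "gaussian_cong (h z) 0 p \<longleftrightarrow> gaussian_cong (g * z) 0 p"
      using h(2)[OF that] gaussian_cong_sym gaussian_cong_trans by blast
    moreover have "\<dots> \<longleftrightarrow> gaussian_cong z 0 p"
      using inert_prime_mult[OF p assms(1) residue_box_gaussian[OF that]] assms
        gaussian_cong_0_mult by blast
    ultimately show ?thesis using that by (simp add: U_def)
  qed
  have inj: "inj_on h U" using h(1) by (auto simp: bij_betw_def U_def intro: inj_on_subset)
  moreover have "h ` U \<subseteq> U" using hU by (auto simp: U_def)
  ultimately have "h ` U = U" using fin by (intro card_subset_eq) (auto simp: card_image)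
  then have "\<Prod>U = (\<Prod>z\<in>U. h z)" using prod.reindex[OF inj, of "\<lambda>z. z"] by simp
  also have "gaussian_cong \<dots> (\<Prod>z\<in>U. g * z) p"
    using h(2) by (intro gaussian_cong_prod) (auto simp: U_def)
  also have "(\<Prod>z\<in>U. g * z) = g ^ (p\<^sup>2 - 1) * \<Prod>U"
    using card_nonzero_residues by (simp add: prod.distrib U_def)
  finally have "gaussian_cong (\<Prod>U * (g ^ (p\<^sup>2 - 1) - 1)) 0 p"
    using gaussian_cong_sym gaussian_cong_diff_0_iff[of "g ^ (p\<^sup>2 - 1) * \<Prod>U" "\<Prod>U"] UG assms(1)
    by (auto simp: algebra_simps)
  moreover have "\<not> gaussian_cong (prod (\<lambda>z. z) V) 0 p" if "V \<subseteq> U" for V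
    using finite_subset[OF that fin] that
  proof (induction V rule: finite_induct)
    case empty
    show ?case using not_gaussian_cong_1_0[OF p(1)] by simp
  next
    case (insert z V)
    then show ?case
      using inert_prime_mult[OF p UG gaussian_ints_prod[of V "\<lambda>z. z"], of z] UG
      by (auto simp: U_def)
  qed
  ultimately have "gaussian_cong (g ^ (p\<^sup>2 - 1) - 1) 0 p"
    using inert_prime_mult[OF p, of "\<Prod>U" "g ^ (p\<^sup>2 - 1) - 1"] UG assms(1) by auto
  then show ?thesis using assms(1) by (simp add: gaussian_cong_diff_0_iff)
qed

text \<open>All \<open>p\<^sup>2 - 1\<close> nonzero residues contribute \<open>1\<close>.\<close>

lemma power_sum_inert_prime_dvd:
  assumes "p\<^sup>2 - 1 dvd k" "k \<ge> 1"
  shows "gaussian_cong (gaussian_power_sum k p) (-1) p"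
proof -
  have pow: "gaussian_cong (z ^ k) (if gaussian_cong z 0 p then 0 else 1) p"
    if "z \<in> residue_box p" for z
  proof (cases "gaussian_cong z 0 p")
    case True
    then show ?thesis using gaussian_cong_power[OF True, of k] assms(2) by (simp add: power_0_left)
  next
    case False
    obtain c where "k = (p\<^sup>2 - 1) * c" using assms(1) by blast
    then show ?thesis
      using gaussian_cong_power[OF gaussian_fermat[OF residue_box_gaussian[OF that] False], of c] False
      by (simp add: power_mult)
  qed
  have "gaussian_cong (gaussian_power_sum k p)
      (\<Sum>z\<in>residue_box p. if gaussian_cong z 0 p then 0 else 1) p"
    (is "gaussian_cong _ ?S p")
    unfolding gaussian_power_sum_residue_box by (intro gaussian_cong_sum pow)
  also have "?S = of_nat (p\<^sup>2 - 1)"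
    unfolding card_nonzero_residues[symmetric] by (simp add: sum.If_cases Int_def)
  also have "\<dots> = -1 + of_nat p * of_nat p"
    using inert_prime_pos by (simp add: of_nat_diff power2_eq_square)
  also have "gaussian_cong \<dots> (-1) p"
    by (rule gaussian_congI[of _ "of_nat p"]) auto
  finally show ?thesis .
qed

text \<open>The substitution \<open>z \<mapsto> g z\<close> shows that the sum \<open>T\<close> satisfies \<open>T \<equiv> g\<^sup>k T\<close> for every nonzero residue \<open>g\<close>. So it
is enough to have one \<open>g\<close> with \<open>g\<^sup>k \<noteq> 1\<close>.\<close>

lemma power_sum_inert_prime_not_dvd:
  assumes "\<not> p\<^sup>2 - 1 dvd k"
  shows "gaussian_cong (gaussian_power_sum k p) 0 p"
proof -
  define r where "r = k mod (p\<^sup>2 - 1)"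
  have "p > 1" using p(1) prime_gt_1_nat by blast
  then have "p\<^sup>2 - 1 > 0" using one_less_power[of p 2] by simp
  then have r: "0 < r" "r < p\<^sup>2 - 1" using assms by (auto simp: r_def mod_greater_zero_iff_not_dvd)
  have red: "gaussian_cong (g ^ k) (g ^ r) p" if "g \<in> gaussian_ints" "\<not> gaussian_cong g 0 p" for g
  proof -
    have "g ^ k = (g ^ (p\<^sup>2 - 1)) ^ (k div (p\<^sup>2 - 1)) * g ^ r"
      unfolding r_def power_mult[symmetric] power_add[symmetric] by simp
    moreover have "gaussian_cong \<dots> (1 ^ (k div (p\<^sup>2 - 1)) * g ^ r) p"
      using that by (intro gaussian_cong_mult gaussian_cong_power gaussian_fermat) auto
    ultimately show ?thesis by simp
  qed
  \<comment> \<open>Otherwise the \<open>p\<^sup>2 - 1\<close> nonzero residues would all be roots of \<open>X\<^sup>r - 1\<close>, whose degree is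
    smaller.\<close>
  have "\<exists>g\<in>gaussian_ints. \<not> gaussian_cong g 0 p \<and> \<not> gaussian_cong (g ^ k) 1 p"
  proof (rule ccontr)
    assume neg: "\<not> ?thesis"
    let ?U = "{z \<in> residue_box p. \<not> gaussian_cong z 0 p}" and ?f = "Polynomial.monom 1 r - 1 :: complex poly"
    have deg: "degree ?f = r" 
      using r(1) degree_add_eq_left[of "-1" "Polynomial.monom (1::complex) r"]
      by (simp add: degree_monom_eq)
    have "card ?U \<le> degree ?f"
    proof (rule monic_poly_roots_mod_inert_prime[OF p])
      show "Polynomial.coeff ?f i \<in> gaussian_ints" for i by (simp add: coeff_1)
      show "lead_coeff ?f = 1" unfolding deg using r(1) by (simp add: coeff_1)
      show "gaussian_cong (poly ?f a) 0 p" if "a \<in> ?U" for a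
      proof -
        have a: "a \<in> gaussian_ints" "\<not> gaussian_cong a 0 p"
          using that residue_box_gaussian by auto
        then have "gaussian_cong (a ^ k) 1 p" using neg by blast
        then have "gaussian_cong (a ^ r) 1 p"
          using red[OF a] gaussian_cong_sym gaussian_cong_trans by blast
        then show ?thesis using a(1) by (simp add: poly_monom gaussian_cong_diff_0_iff)
      qed
    qed (use residue_box_gaussian residue_box_cong_eq in auto)
    then show False using r(2) deg card_nonzero_residues by simp
  qed
  then obtain g where g: "g \<in> gaussian_ints" "\<not> gaussian_cong g 0 p" "\<not> gaussian_cong (g ^ k) 1 p"
    by blast
  obtain h where h: "bij_betw h (residue_box p) (residue_box p)"
    "\<And>z. z \<in> residue_box p \<Longrightarrow> gaussian_cong (h z) (g * z) p"
    using mult_permutes_residues[OF g(1,2)] by blast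
  let ?T = "gaussian_power_sum k p"
  have "?T = (\<Sum>z\<in>residue_box p. h z ^ k)"
    unfolding gaussian_power_sum_residue_box by (rule sum.reindex_bij_betw[OF h(1), symmetric])
  also have "gaussian_cong \<dots> (\<Sum>z\<in>residue_box p. (g * z) ^ k) p"
    using h(2) by (intro gaussian_cong_sum gaussian_cong_power)
  also have "(\<Sum>z\<in>residue_box p. (g * z) ^ k) = g ^ k * ?T"
    by (simp add: gaussian_power_sum_residue_box power_mult_distrib sum_distrib_left)
  finally have "gaussian_cong ((g ^ k - 1) * ?T) 0 p"
    using gaussian_cong_sym gaussian_cong_diff_0_iff[of "g ^ k * ?T" ?T p] g(1)
    by (auto simp: algebra_simps)
  then show ?thesis
    using inert_prime_mult[OF p, of "g ^ k - 1" ?T] g by (auto simp: gaussian_cong_diff_0_iff)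
qed

end

section \<open>The primes that keep a number out of the set\<close>

text \<open>Modulo \<open>2\<close> the squares of the four residues are \<open>0, 1, 1, 0\<close>.\<close>

lemma power_sum_two:
  assumes "even k" "k \<ge> 1"
  shows "gaussian_cong (gaussian_power_sum k 2) 0 2"
proof -
  obtain m where m: "k = 2 * m" using assms(1) by blast
  then have m0: "m > 0" using assms(2) by simp
  have "gaussian_power_sum k 2 =
      ((1 + \<i>)\<^sup>2) ^ m + ((1 + 2 * \<i>)\<^sup>2) ^ m + (((2 + \<i>)\<^sup>2) ^ m + ((2 + 2 * \<i>)\<^sup>2) ^ m)"
  proof -
    have "{Suc 0..2} = {1, 2}" by auto
    then show ?thesis by (simp add: gaussian_power_sum_def m power_mult)
  qed
  also have "gaussian_cong \<dots> (0 ^ m + 1 ^ m + (1 ^ m + 0 ^ m)) 2"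
  proof (intro gaussian_cong_add gaussian_cong_power)
    show "gaussian_cong ((1 + \<i>)\<^sup>2) 0 2"
      by (rule gaussian_congI[of _ "\<i>"]) (auto simp: power2_eq_square algebra_simps)
    show "gaussian_cong ((1 + 2 * \<i>)\<^sup>2) 1 2"
      using gaussian_ints_intro[of "-2" 2]
      by (intro gaussian_congI[of _ "of_int (-2) + of_int 2 * \<i>"]) (auto simp: power2_eq_square algebra_simps)
    show "gaussian_cong ((2 + \<i>)\<^sup>2) 1 2"
      using gaussian_ints_intro[of 1 2]
      by (intro gaussian_congI[of _ "of_int 1 + of_int 2 * \<i>"]) (auto simp: power2_eq_square algebra_simps)
    show "gaussian_cong ((2 + 2 * \<i>)\<^sup>2) 0 2"
      using gaussian_ints_intro[of 0 4]
      by (intro gaussian_congI[of _ "of_int 0 + of_int 4 * \<i>"]) (auto simp: power2_eq_square algebra_simps)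
  qed
  also have "0 ^ m + 1 ^ m + (1 ^ m + 0 ^ m) = (of_nat 2 :: complex)" using m0 by simp
  also have "gaussian_cong \<dots> 0 2" by (simp only: gaussian_cong_of_nat_0_iff dvd_refl)
  finally show ?thesis .
qed

lemma M_set_iff:
  assumes "n \<ge> 1"
  shows "n \<in> M_set \<longleftrightarrow> (\<nexists>p. prime p \<and> p mod 4 = 3 \<and> p dvd n \<and> \<not> p\<^sup>2 dvd n \<and> p\<^sup>2 - 1 dvd n)"
proof
  assume "n \<in> M_set"
  then have G: "gaussian_cong (gaussian_power_sum n n) 0 n" by (simp add: M_set_def)
  show "\<nexists>p. prime p \<and> p mod 4 = 3 \<and> p dvd n \<and> \<not> p\<^sup>2 dvd n \<and> p\<^sup>2 - 1 dvd n"
  proof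
    assume "\<exists>p. prime p \<and> p mod 4 = 3 \<and> p dvd n \<and> \<not> p\<^sup>2 dvd n \<and> p\<^sup>2 - 1 dvd n"
    then obtain p t where p: "prime p" "p mod 4 = 3" "\<not> p\<^sup>2 dvd n" "p\<^sup>2 - 1 dvd n" and t: "n = p * t"
      by blast
    \<comment> \<open>Modulo \<open>p\<close> the sum is \<open>-t\<^sup>2\<close>, and \<open>p\<close> does not divide \<open>t\<close>.\<close>
    have "gaussian_cong 0 (gaussian_power_sum n n) p"
      using G gaussian_cong_dvd_modulus[OF G, of p] gaussian_cong_sym t by simp
    also have "gaussian_cong (gaussian_power_sum n n) ((of_nat t)\<^sup>2 * gaussian_power_sum n p) p"
      using gaussian_power_sum_reduce[of p 1 t] t by simp
    also have "gaussian_cong ((of_nat t)\<^sup>2 * gaussian_power_sum n p) ((of_nat t)\<^sup>2 * (-1)) p"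
      by (intro gaussian_cong_mult power_sum_inert_prime_dvd p assms) auto
    finally have "gaussian_cong 0 ((of_nat t)\<^sup>2 * (-1)) p" .
    from gaussian_cong_0_mult[OF gaussian_cong_sym[OF this], of "of_int (-1)"]
    have "gaussian_cong (of_nat (t\<^sup>2)) 0 p" by simp
    then have "p dvd t\<^sup>2" unfolding gaussian_cong_of_nat_0_iff .
    then have "p dvd t" using p(1) prime_dvd_power by blast
    then show False using p(3) t by (simp add: power2_eq_square)
  qed
next
  assume neg: "\<nexists>p. prime p \<and> p mod 4 = 3 \<and> p dvd n \<and> \<not> p\<^sup>2 dvd n \<and> p\<^sup>2 - 1 dvd n"
  have "gaussian_cong (gaussian_power_sum n n) 0 n"
  proof (rule gaussian_cong_0_by_prime_powers)
    fix p assume p: "prime p" "p dvd n"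
    define e where "e = multiplicity p n"
    obtain t where t: "n = p * t" using p(2) by blast
    have dvd: "p ^ e dvd n" by (simp add: e_def multiplicity_dvd)
    have e: "e \<ge> 1" unfolding e_def using p assms by (intro multiplicity_geI) auto
    have "gaussian_cong (gaussian_power_sum n n) ((of_nat t)\<^sup>2 * gaussian_power_sum n p) (p ^ e)"
      using gaussian_power_sum_reduce[of p e t] dvd e t by simp
    also have "gaussian_cong ((of_nat t)\<^sup>2 * gaussian_power_sum n p) 0 (p ^ e)"
    proof (cases "e = 1")
      case True
      have "\<not> p\<^sup>2 dvd n"
        using True p assms power_dvd_iff_le_multiplicity[of n p 2] prime_gt_1_nat[OF p(1)]
        by (auto simp: e_def)
      moreover have "p = 2 \<or> p mod 4 = 1 \<or> p mod 4 = 3"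
        using prime_odd_nat[OF p(1)] prime_ge_2_nat[OF p(1)] by (cases "p = 2") presburger+
      ultimately consider "p = 2" | "p mod 4 = 1" | "p mod 4 = 3" "\<not> p\<^sup>2 - 1 dvd n"
        using neg p by blast
      then have "gaussian_cong (gaussian_power_sum n p) 0 p"
      proof cases
        case 1
        then show ?thesis using power_sum_two[of n] p(2) assms by simp
      next
        case 2
        then show ?thesis by (rule power_sum_split_prime[OF p(1)])
      next
        case 3
        then show ?thesis using power_sum_inert_prime_not_dvd[OF p(1)] by blast
      qed
      then show ?thesis using True by (simp add: gaussian_cong_0_mult)
    next
      case False
      then obtain f where f: "e = f + 2" using e by (metis le_Suc_ex add.commute Suc_1 Suc_leI le_neq_implies_less)
      \<comment> \<open>Now \<open>p\<^sup>e\<^sup>-\<^sup>1\<close> divides \<open>t\<close>, and \<open>2 (e - 1) \<ge> e\<close> makes the factor \<open>t\<^sup>2\<close> vanish.\<close>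
      have "p * p ^ (f + 1) dvd p * t" using dvd t f by (simp add: mult.assoc)
      then have "p ^ (f + 1) dvd t" using p(1) by (simp add: prime_gt_0_nat)
      then have "p ^ (f + 1) * p ^ (f + 1) dvd t * t" by (intro mult_dvd_mono)
      moreover have "p ^ e dvd p ^ (f + 1) * p ^ (f + 1)"
        unfolding f power_add[symmetric] by (rule le_imp_power_dvd) simp
      ultimately have "p ^ e dvd t\<^sup>2" by (metis dvd_trans power2_eq_square)
      then have "gaussian_cong (of_nat (t\<^sup>2)) 0 (p ^ e)" unfolding gaussian_cong_of_nat_0_iff .
      from gaussian_cong_0_mult[OF this, of "gaussian_power_sum n p"] show ?thesis
        by (simp add: mult.commute)
    qed
    finally show "gaussian_cong (gaussian_power_sum n n) 0 (p ^ multiplicity p n)"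
      unfolding e_def .
  qed (use assms in auto)
  then show "n \<in> M_set" using assms by (simp add: M_set_def)
qed

text \<open>The numbers that the prime \<open>q\<close> keeps out of the set. Integers are used so that \<open>q * q - 1\<close> is a true
difference.\<close>

definition bad_at :: "int \<Rightarrow> nat set" where
  "bad_at q = {n. q * (q * q - 1) dvd int n \<and> \<not> q * q dvd int n}"

definition bad :: "nat set" where
  "bad = {n. \<exists>p. prime p \<and> p mod 4 = 3 \<and> n \<in> bad_at p}"

lemma mem_bad_at_iff:
  assumes "prime p"
  shows "n \<in> bad_at (int p) \<longleftrightarrow> p dvd n \<and> \<not> p\<^sup>2 dvd n \<and> p\<^sup>2 - 1 dvd n"
proof -
  have p1: "p \<ge> 1" using assms prime_ge_1_nat by blast
  then have eq: "int p * int p - 1 = int (p\<^sup>2 - 1)" by (simp add: of_nat_diff power2_eq_square)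
  have "coprime p (p\<^sup>2 - 1)"
  proof -
    have "coprime (p\<^sup>2) (p\<^sup>2 - 1)" using p1 by (intro coprime_diff_one_right_nat) simp
    then show ?thesis by simp
  qed
  then have "p * (p\<^sup>2 - 1) dvd n \<longleftrightarrow> p dvd n \<and> p\<^sup>2 - 1 dvd n"
    by (meson divides_mult dvd_mult_left dvd_mult_right)
  then show ?thesis
    unfolding bad_at_def eq by (auto simp: power2_eq_square simp flip: of_nat_mult)
qed

lemma M_set_eq: "M_set = {1..} - bad"
proof -
  have "n \<in> bad \<longleftrightarrow> (\<exists>p. prime p \<and> p mod 4 = 3 \<and> p dvd n \<and> \<not> p\<^sup>2 dvd n \<and> p\<^sup>2 - 1 dvd n)" for n
  proof
    assume "n \<in> bad"
    then obtain q where q: "prime q" "q mod 4 = 3" "n \<in> bad_at q" by (auto simp: bad_def)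
    define p where "p = nat q"
    have qp: "q = int p" using q(1) prime_ge_0_int by (simp add: p_def)
    have "int (p mod 4) = int 3" using q(2) by (simp add: qp zmod_int)
    then have "prime p \<and> p mod 4 = 3 \<and> n \<in> bad_at (int p)" using q by (simp add: qp)
    then show "\<exists>p. prime p \<and> p mod 4 = 3 \<and> p dvd n \<and> \<not> p\<^sup>2 dvd n \<and> p\<^sup>2 - 1 dvd n"
      using mem_bad_at_iff by blast
  next
    assume "\<exists>p. prime p \<and> p mod 4 = 3 \<and> p dvd n \<and> \<not> p\<^sup>2 dvd n \<and> p\<^sup>2 - 1 dvd n"
    then obtain p where p: "prime p" "p mod 4 = 3" "n \<in> bad_at (int p)"
      using mem_bad_at_iff by blast
    have "int p mod 4 = 3" using p(2) by (metis of_nat_mod of_nat_numeral)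
    with p show "n \<in> bad" unfolding bad_def by (intro CollectI exI[of _ "int p"]) simp
  qed
  then show ?thesis using M_set_iff by (auto simp: M_set_def)
qed

section \<open>Asymptotic density\<close>

lemma density_unique:
  "has_asymptotic_density A a \<Longrightarrow> has_asymptotic_density A b \<Longrightarrow> a = b"
  unfolding has_asymptotic_density_def by (rule LIMSEQ_unique)

lemma density_empty: "has_asymptotic_density {} 0"
  by (simp add: has_asymptotic_density_def)

lemma density_Diff:
  assumes "has_asymptotic_density A a" "has_asymptotic_density B b" "B \<subseteq> A"
  shows "has_asymptotic_density (A - B) (a - b)"
proof -
  have "real (card ((A - B) \<inter> {1..N})) = real (card (A \<inter> {1..N})) - real (card (B \<inter> {1..N}))" for N
  proof -
    have "(A - B) \<inter> {1..N} = A \<inter> {1..N} - B \<inter> {1..N}" by auto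
    moreover have "card (A \<inter> {1..N} - B \<inter> {1..N}) = card (A \<inter> {1..N}) - card (B \<inter> {1..N})"
      using assms(3) by (intro card_Diff_subset) auto
    moreover have "card (B \<inter> {1..N}) \<le> card (A \<inter> {1..N})"
      using assms(3) by (intro card_mono) auto
    ultimately show ?thesis by simp
  qed
  then show ?thesis
    using tendsto_diff[OF assms(1,2)[unfolded has_asymptotic_density_def]]
    by (simp add: has_asymptotic_density_def diff_divide_distrib)
qed

lemma density_Un_disjoint:
  assumes "has_asymptotic_density A a" "has_asymptotic_density B b" "A \<inter> B = {}"
  shows "has_asymptotic_density (A \<union> B) (a + b)"
proof -
  have "real (card ((A \<union> B) \<inter> {1..N})) = real (card (A \<inter> {1..N})) + real (card (B \<inter> {1..N}))" for N
  proof -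
    have "(A \<union> B) \<inter> {1..N} = A \<inter> {1..N} \<union> B \<inter> {1..N}" by auto
    moreover have "card (A \<inter> {1..N} \<union> B \<inter> {1..N}) = card (A \<inter> {1..N}) + card (B \<inter> {1..N})"
      using assms(3) by (intro card_Un_disjoint) auto
    ultimately show ?thesis by simp
  qed
  then show ?thesis
    using tendsto_add[OF assms(1,2)[unfolded has_asymptotic_density_def]]
    by (simp add: has_asymptotic_density_def add_divide_distrib)
qed

lemma card_multiples:
  assumes "L > 0"
  shows "card ({n. L dvd n} \<inter> {1..N}) = N div (L::nat)"
proof -
  have "{n. L dvd n} \<inter> {1..N} = (\<lambda>k. L * k) ` {1..N div L}"
  proof (intro subset_antisym subsetI)
    fix n assume "n \<in> {n. L dvd n} \<inter> {1..N}"
    then obtain k where "n = L * k" "1 \<le> L * k" "L * k \<le> N" by auto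
    with assms show "n \<in> (\<lambda>k. L * k) ` {1..N div L}"
      by (auto simp: less_eq_div_iff_mult_less_eq mult.commute)
  qed (use assms in \<open>auto simp: less_eq_div_iff_mult_less_eq mult.commute\<close>)
  then show ?thesis using assms by (simp add: card_image inj_on_def)
qed

lemma multiples_count_le: "L > 0 \<Longrightarrow> real (card ({n. L dvd n} \<inter> {1..N})) \<le> real N / real L"
  by (simp add: card_multiples of_nat_div_le_of_nat del: One_nat_def)

lemma density_multiples:
  assumes "L > 0"
  shows "has_asymptotic_density {n. L dvd n} (1 / real L)"
proof -
  have "(\<lambda>N. real (N div L) / real N) \<longlonglongrightarrow> 1 / real L"
  proof (rule tendsto_sandwich)
    have "real N / real L - 1 \<le> real (N div L)" for N
      using floor_correct[of "real N / real L"] by (simp add: floor_divide_of_nat_eq)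
    then have "1 / real L - 1 / real N \<le> real (N div L) / real N" if "N > 0" for N
      using that assms divide_right_mono[of "real N / real L - 1" "real (N div L)" "real N"]
      by (simp add: diff_divide_distrib)
    then show "\<forall>\<^sub>F N in sequentially. 1 / real L - 1 / real N \<le> real (N div L) / real N"
      using eventually_gt_at_top[of 0] by (rule eventually_mono[rotated])
    show "\<forall>\<^sub>F N in sequentially. real (N div L) / real N \<le> 1 / real L"
      using eventually_gt_at_top[of 0]
    proof eventually_elim
      case (elim N)
      have "real (N div L) / real N \<le> (real N / real L) / real N"
        by (intro divide_right_mono of_nat_div_le_of_nat) auto
      with elim show ?case by simp
    qed
    show "(\<lambda>N. 1 / real L - 1 / real N) \<longlonglongrightarrow> 1 / real L"
      using tendsto_diff[OF tendsto_const lim_1_over_n, of "1 / real L"] by simp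
  qed auto
  then show ?thesis
    using assms by (simp add: has_asymptotic_density_def card_multiples del: One_nat_def)
qed

lemma density_int_multiples:
  assumes "L > 0"
  shows "has_asymptotic_density {n. L dvd int n} (1 / of_int L)"
  using density_multiples[of "nat L"] assms by (simp add: nat_dvd_iff)

lemma density_le_add:
  assumes "has_asymptotic_density A a" "has_asymptotic_density B b"
    and le: "\<And>N. real (card (A \<inter> {1..N})) \<le> real (card (B \<inter> {1..N})) + e * real N"
  shows "a \<le> b + e"
proof -
  have "(\<lambda>N. real (card (B \<inter> {1..N})) / real N + e) \<longlonglongrightarrow> b + e"
    using assms(2) unfolding has_asymptotic_density_def by (intro tendsto_intros)
  moreover have "real (card (A \<inter> {1..N})) / real N \<le> real (card (B \<inter> {1..N})) / real N + e"
    if "N \<ge> 1" for N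
    using le[of N] that by (simp add: field_simps)
  ultimately show ?thesis
    using LIMSEQ_le assms(1) unfolding has_asymptotic_density_def by blast
qed

lemma density_mono:
  assumes "has_asymptotic_density A a" "has_asymptotic_density B b" "A \<subseteq> B"
  shows "a \<le> b"
proof -
  have "card (A \<inter> {1..N}) \<le> card (B \<inter> {1..N})" for N
    using assms(3) by (intro card_mono) auto
  then show ?thesis using density_le_add[OF assms(1,2), of 0] by simp
qed

text \<open>Cauchy's criterion: the relative counts stay within the given distance of a convergent sequence, uniformly
in \<open>N\<close>.\<close>

lemma density_exists_by_approximation:
  assumes "\<And>e. e > 0 \<Longrightarrow> \<exists>C c. C \<subseteq> A \<and> has_asymptotic_density C c \<and>
      (\<forall>N. real (card (A \<inter> {1..N})) \<le> real (card (C \<inter> {1..N})) + e * real N)"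
  shows "\<exists>d. has_asymptotic_density A d"
proof -
  let ?a = "\<lambda>N. real (card (A \<inter> {1..N})) / real N"
  have "Cauchy ?a"
  proof (rule metric_CauchyI)
    fix e :: real assume "e > 0"
    then obtain C c where C: "C \<subseteq> A" "has_asymptotic_density C c"
      "\<And>N. real (card (A \<inter> {1..N})) \<le> real (card (C \<inter> {1..N})) + e / 4 * real N"
      using assms[of "e / 4"] by auto
    let ?c = "\<lambda>N. real (card (C \<inter> {1..N})) / real N"
    have near: "dist (?a N) (?c N) \<le> e / 4" if "N \<ge> 1" for N
    proof -
      have "card (C \<inter> {1..N}) \<le> card (A \<inter> {1..N})" using C(1) by (intro card_mono) auto
      then have "?c N \<le> ?a N" by (simp add: divide_right_mono)
      moreover have "?a N \<le> ?c N + e / 4" using C(3)[of N] that by (simp add: field_simps)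
      ultimately show ?thesis unfolding dist_real_def by linarith
    qed
    have "Cauchy ?c"
      using C(2) unfolding has_asymptotic_density_def by (rule LIMSEQ_imp_Cauchy)
    then obtain M where M: "\<And>m n. m \<ge> M \<Longrightarrow> n \<ge> M \<Longrightarrow> dist (?c m) (?c n) < e / 4"
      using \<open>e > 0\<close> metric_CauchyD[of ?c "e / 4"] by (metis divide_pos_pos zero_less_numeral)
    have "dist (?a m) (?a n) < e" if "m \<ge> max M 1" "n \<ge> max M 1" for m n
    proof -
      have "dist (?a m) (?a n) \<le> dist (?a m) (?c m) + dist (?c m) (?c n) + dist (?a n) (?c n)"
        by (smt (verit) dist_commute dist_triangle)
      with near[of m] near[of n] M[of m n] that \<open>e > 0\<close> show ?thesis by linarith
    qed
    then show "\<exists>M. \<forall>m\<ge>M. \<forall>n\<ge>M. dist (?a m) (?a n) < e" by blast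
  qed
  then show ?thesis
    unfolding has_asymptotic_density_def by (simp add: Cauchy_convergent_iff convergent_def)
qed

section \<open>Densities of sets defined by finitely many primes\<close>

text \<open>This family is closed under splitting by one more set \<^term>\<open>bad_at q\<close>: membership in it only changes the
modulus \<open>L\<close> and adds the condition that \<open>q * q\<close> does not divide the number. Inclusion and exclusion over
\<open>R\<close> becomes a recursion.\<close>

definition sieved :: "int \<Rightarrow> int list \<Rightarrow> int list \<Rightarrow> nat set" where
  "sieved L S R =
     {n. L dvd int n \<and> (\<forall>p\<in>set S. \<not> p * p dvd int n) \<and> (\<forall>q\<in>set R. n \<notin> bad_at q)}"

lemma sieved_Cons:
  "sieved L S (q # R) = sieved L S R - sieved (lcm L (q * (q * q - 1))) (q # S) R"
  by (auto simp: sieved_def bad_at_def)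

lemma sieved_lcm_subset: "sieved (lcm L m) (q # S) R \<subseteq> sieved L S R"
  by (auto simp: sieved_def)

lemma sieved_subset_multiples: "sieved L S R \<subseteq> {n. L dvd int n}"
  by (auto simp: sieved_def)

lemma sieved_empty_if_square_dvd: "p \<in> set S \<Longrightarrow> p * p dvd L \<Longrightarrow> sieved L S R = {}"
  by (auto simp: sieved_def dest: dvd_trans)

lemma prime_square_dvd_iff:
  fixes p L n :: int
  assumes "prime p" "p dvd L" "\<not> p * p dvd L" "L dvd n"
  shows "p * p dvd n \<longleftrightarrow> L * p dvd n"
proof -
  obtain m where m: "L = p * m" using assms(2) by blast
  have p0: "p \<noteq> 0" using assms(1) by auto
  have "\<not> p dvd m" using assms(3) m by (auto simp: mult_dvd_mono)
  then have cop: "coprime m p" using assms(1) by (metis prime_imp_coprime coprime_commute)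
  obtain k where k: "n = p * k" using assms(4) m by (metis dvd_def mult.assoc)
  have "m dvd k" using assms(4) m k p0 by simp
  then have "p dvd k \<longleftrightarrow> m * p dvd k"
    using cop by (meson divides_mult dvd_mult_right)
  then show ?thesis using p0 by (simp add: m k mult.assoc)
qed

text \<open>A prime \<open>p\<close> dividing \<open>L\<close> exactly once divides \<open>n / L\<close> for one in \<open>p\<close> multiples \<open>n\<close> of \<open>L\<close>, independently for
different primes. So each condition in \<open>S\<close> contributes the factor \<open>1 - 1 / p\<close>.\<close>

lemma density_sieved_Nil:
  assumes "L > 0" "distinct S" "\<And>p. p \<in> set S \<Longrightarrow> prime p \<and> p dvd L \<and> \<not> p * p dvd L"
  shows "has_asymptotic_density (sieved L S [])
           (of_int (\<Prod>p\<leftarrow>S. p - 1) / of_int (L * (\<Prod>p\<leftarrow>S. p)))"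
  using assms
proof (induction S arbitrary: L)
  case Nil
  then show ?case using density_int_multiples[of L] by (simp add: sieved_def)
next
  case (Cons p S)
  have p: "prime p" "p dvd L" "\<not> p * p dvd L" and pS: "p \<notin> set S"
    using Cons.prems by auto
  have p0: "p > 0" using p(1) by (simp add: prime_gt_0_int)
  have "sieved L (p # S) [] = sieved L S [] - sieved (L * p) S []"
    using prime_square_dvd_iff[OF p] by (auto simp: sieved_def dest: dvd_mult_left)
  moreover have "sieved (L * p) S [] \<subseteq> sieved L S []"
    by (auto simp: sieved_def dest: dvd_mult_left)
  moreover have "prime q \<and> q dvd L * p \<and> \<not> q * q dvd L * p" if "q \<in> set S" for q
  proof -
    have q: "prime q" "q dvd L" "\<not> q * q dvd L" using Cons.prems(3)[of q] that by auto
    have "q \<noteq> p" using that pS by auto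
    then have "coprime (q * q) p" using q(1) p(1) by (simp add: primes_coprime)
    then have "\<not> q * q dvd L * p" using q(3) by (simp add: coprime_dvd_mult_left_iff)
    with q show ?thesis by simp
  qed
  moreover have "0 < L * p" using p0 Cons.prems(1) by simp
  moreover have "prime q \<and> q dvd L \<and> \<not> q * q dvd L" if "q \<in> set S" for q
    using Cons.prems(3)[of q] that by auto
  ultimately have "has_asymptotic_density (sieved L (p # S) [])
      (of_int (\<Prod>p\<leftarrow>S. p - 1) / of_int (L * (\<Prod>p\<leftarrow>S. p))
       - of_int (\<Prod>p\<leftarrow>S. p - 1) / of_int (L * p * (\<Prod>p\<leftarrow>S. p)))"
    using Cons.IH[of L] Cons.IH[of "L * p"] Cons.prems(1,2) by (auto intro!: density_Diff)
  moreover have "(\<Prod>p\<leftarrow>S. p) \<noteq> 0"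
    using Cons.prems(3)[of 0] by (auto simp: prod_list_zero_iff)
  ultimately show ?case using p0 Cons.prems(1)
    by (simp add: field_simps)
qed

lemma lcm_sieve_modulus_pos:
  "L > 0 \<Longrightarrow> q > 1 \<Longrightarrow> lcm L (q * (q * q - 1)) > (0 :: int)"
  by (simp add: lcm_pos_int less_1_mult order_less_imp_not_eq2)

text \<open>If some \<open>p\<close> in \<open>S\<close> has its square dividing \<open>L\<close>, the conditions contradict each other and the set is empty.\<close>

lemma density_sieved_exists:
  assumes "L > 0" "distinct (S @ R)" "\<And>p. p \<in> set S \<Longrightarrow> prime p \<and> p dvd L" "\<And>q. q \<in> set R \<Longrightarrow> prime q"
  shows "\<exists>d. has_asymptotic_density (sieved L S R) d"
  using assms
proof (induction R arbitrary: L S)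
  case Nil
  show ?case
  proof (cases "\<exists>p\<in>set S. p * p dvd L")
    case True
    then have "sieved L S [] = {}" using sieved_empty_if_square_dvd by blast
    then show ?thesis using density_empty by auto
  next
    case False
    then show ?thesis using Nil density_sieved_Nil[of L S] by auto
  qed
next
  case (Cons q R)
  let ?L = "lcm L (q * (q * q - 1))"
  have q: "prime q" using Cons.prems by simp
  have "q > 1" using q by (simp add: prime_gt_1_int)
  then have "?L > 0" using Cons.prems(1) by (intro lcm_sieve_modulus_pos)
  moreover have "prime p \<and> p dvd ?L" if "p \<in> set (q # S)" for p
    using that Cons.prems(3)[of p] q by (auto intro: dvd_trans[OF _ dvd_lcm2] dvd_lcmI1)
  ultimately obtain b where "has_asymptotic_density (sieved ?L (q # S) R) b"
    using Cons.IH[of ?L "q # S"] Cons.prems by auto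
  moreover obtain a where "has_asymptotic_density (sieved L S R) a"
    using Cons.IH[of L S] Cons.prems by auto
  ultimately show ?case
    unfolding sieved_Cons using density_Diff sieved_lcm_subset by blast
qed

section \<open>The contribution of large primes and the existence of the density\<close>

text \<open>It suffices to run through all \<open>m \<equiv> 3 (mod 4)\<close> instead of the primes among them, since the sum over
\<open>m\<close> is small enough and telescopes.\<close>

definition large_multiples :: "nat \<Rightarrow> nat set" where
  "large_multiples J = {n. \<exists>j\<ge>J. (4 * int j + 3) * ((4 * int j + 3) * (4 * int j + 3) - 1) dvd int n}"

lemma int_multiples_count_le:
  "L > 0 \<Longrightarrow> real (card ({n. L dvd int n} \<inter> {1..N})) \<le> real N / of_int L"
  using multiples_count_le[of "nat L" N] by (simp add: nat_dvd_iff)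

text \<open>For \<open>m = 4 j + 3\<close> the right-hand side is \<open>m / (m\<^sup>2 - 4)\<^sup>2\<close>.\<close>

lemma telescoping_step:
  fixes j :: nat
  assumes "j \<ge> 1"
  defines "m \<equiv> 4 * real j + 3"
  shows "1 / (m * (m * m - 1)) \<le> 1 / (8 * (4 * real j + 1)\<^sup>2) - 1 / (8 * (4 * real (Suc j) + 1)\<^sup>2)"
proof -
  have m: "m \<ge> 7" and j: "4 * real j + 1 = m - 2" "4 * real (Suc j) + 1 = m + 2"
    using assms by (auto simp: m_def)
  have "1 / (8 * (m - 2)\<^sup>2) - 1 / (8 * (m + 2)\<^sup>2) = m / ((m * m - 4) * (m * m - 4))"
  proof -
    have "(m - 2)\<^sup>2 * (m + 2)\<^sup>2 = (m * m - 4) * (m * m - 4)"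
      by (simp add: power2_eq_square algebra_simps)
    moreover have "(m + 2)\<^sup>2 - (m - 2)\<^sup>2 = 8 * m"
      by (simp add: power2_eq_square algebra_simps)
    moreover have "1 / (8 * (m - 2)\<^sup>2) - 1 / (8 * (m + 2)\<^sup>2) =
        ((m + 2)\<^sup>2 - (m - 2)\<^sup>2) / (8 * ((m - 2)\<^sup>2 * (m + 2)\<^sup>2))"
      using m by (simp add: divide_simps)
    ultimately show ?thesis by simp
  qed
  moreover have "1 / (m * (m * m - 1)) = m / (m * m * (m * m - 1))"
    using m by simp
  moreover have "m / (m * m * (m * m - 1)) \<le> m / ((m * m - 4) * (m * m - 4))"
  proof -
    have "m * m \<ge> 7 * 7" using m by (intro mult_mono) auto
    then show ?thesis using m by (intro divide_left_mono mult_mono mult_pos_pos) auto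
  qed
  ultimately show ?thesis unfolding j by simp
qed

lemma large_multiples_count_le:
  assumes "J \<ge> 1"
  shows "real (card (large_multiples J \<inter> {1..N})) \<le> 1 / (8 * (4 * real J + 1)\<^sup>2) * real N"
proof -
  define m where "m j = 4 * int j + 3" for j
  define f where "f j = 1 / (8 * (4 * real j + 1)\<^sup>2)" for j
  define A where "A j = {n. m j * (m j * m j - 1) dvd int n} \<inter> {1..N}" for j
  have pos: "m j * (m j * m j - 1) > 0" for j
    by (auto simp: m_def intro!: mult_pos_pos less_1_mult)
  have "large_multiples J \<inter> {1..N} \<subseteq> (\<Union>j\<in>{J..<J + N}. A j)"
  proof
    fix n assume "n \<in> large_multiples J \<inter> {1..N}"
    \<comment> \<open>As \<open>m j (m j\<^sup>2 - 1) > j\<close>, no index \<open>j \<ge> N\<close> matters up to \<open>N\<close>.\<close>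
    then obtain j where j: "j \<ge> J" "m j * (m j * m j - 1) dvd int n" and n: "1 \<le> n" "n \<le> N"
      by (auto simp: large_multiples_def m_def)
    have "m j * 1 \<le> m j * (m j * m j - 1)"
      using pos[of j] by (intro mult_left_mono) (auto simp: m_def zero_less_mult_iff)
    also have "\<dots> \<le> int n" using j(2) n by (intro zdvd_imp_le) auto
    finally have "j < N" using n by (simp add: m_def)
    with j n show "n \<in> (\<Union>j\<in>{J..<J + N}. A j)" by (auto simp: A_def)
  qed
  then have "card (large_multiples J \<inter> {1..N}) \<le> card (\<Union>j\<in>{J..<J + N}. A j)"
    by (intro card_mono) (auto simp: A_def)
  also have "\<dots> \<le> (\<Sum>j=J..<J + N. card (A j))" by (intro card_UN_le) auto
  finally have "real (card (large_multiples J \<inter> {1..N})) \<le> (\<Sum>j=J..<J + N. real (card (A j)))"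
    by (metis of_nat_le_iff of_nat_sum)
  also have "\<dots> \<le> (\<Sum>j=J..<J + N. real N * (f j - f (Suc j)))"
  proof (intro sum_mono)
    fix j assume "j \<in> {J..<J + N}"
    then have "j \<ge> 1" using assms by simp
    have "real (card (A j)) \<le> real N * (1 / of_int (m j * (m j * m j - 1)))"
      using int_multiples_count_le[OF pos] by (simp add: A_def)
    also have "of_int (m j * (m j * m j - 1)) =
        (4 * real j + 3) * ((4 * real j + 3) * (4 * real j + 3) - 1)" by (simp add: m_def)
    also have "real N * (1 / \<dots>) \<le> real N * (f j - f (Suc j))"
      unfolding f_def by (intro mult_left_mono telescoping_step \<open>j \<ge> 1\<close>) auto
    finally show "real (card (A j)) \<le> real N * (f j - f (Suc j))" .
  qed
  also have "\<dots> = real N * (f J - f (J + N))"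
    using sum_Suc_diff'[of J "J + N" "\<lambda>j. - f j"] by (simp add: sum_distrib_left[symmetric])
  also have "\<dots> \<le> real N * f J" by (intro mult_left_mono) (auto simp: f_def)
  finally show ?thesis by (simp add: f_def)
qed

lemma card_Un_Int_le: "card ((A \<union> B) \<inter> {1..N}) \<le> card (A \<inter> {1..N}) + card (B \<inter> {1..N::nat})"
  using card_Un_le[of "A \<inter> {1..N}" "B \<inter> {1..N}"] by (simp add: Int_Un_distrib2)

lemma density_UNIV: "has_asymptotic_density UNIV 1"
  using density_multiples[of 1] by simp

lemma int_3_mod_4_cases:
  assumes "p mod 4 = 3" "p > 0"
  obtains j :: nat where "p = 4 * int j + 3"
proof
  show "p = 4 * int (nat (p div 4)) + 3"
    using assms mult_div_mod_eq[of 4 p] by (simp add: pos_imp_zdiv_nonneg_iff)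
qed

text \<open>The sets with only the primes below \<open>4 K + 3\<close> approximate the whole set up to the multiples counted in
\<open>large_multiples_count_le\<close>.\<close>

lemma density_bad_exists: "\<exists>d. has_asymptotic_density bad d"
proof (rule density_exists_by_approximation)
  fix e :: real assume "e > 0"
  obtain J :: nat where J: "inverse (of_nat (Suc J)) < e" using reals_Archimedean[OF \<open>e > 0\<close>] by auto
  define K where "K = Suc J"
  have K: "1 / (8 * (4 * real K + 1)\<^sup>2) \<le> e"
  proof -
    have "real K * 1 \<le> (8 * (4 * real K + 1)) * (4 * real K + 1)"
      by (intro mult_mono) auto
    then have "real K \<le> 8 * (4 * real K + 1)\<^sup>2"
      by (simp only: power2_eq_square mult.assoc mult_1_right)
    then have "1 / (8 * (4 * real K + 1)\<^sup>2) \<le> 1 / real K"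
      by (rule divide_left_mono) (auto simp: K_def intro!: mult_pos_pos)
    also have "\<dots> \<le> e" using J by (simp add: K_def field_simps)
    finally show ?thesis .
  qed
  define P where "P = {p::int. prime p \<and> p mod 4 = 3 \<and> p < 4 * int K + 3}"
  have "P \<subseteq> {0..4 * int K + 3}" by (auto simp: P_def prime_ge_0_int)
  then have "finite P" by (rule finite_subset) simp
  then obtain R where R: "set R = P" "distinct R" using finite_distinct_list by metis
  have "prime q" if "q \<in> set R" for q using that R(1) unfolding P_def by blast
  then obtain c where "has_asymptotic_density (sieved 1 [] R) c"
    using density_sieved_exists[of 1 "[]" R] R(2) by fastforce
  then have c: "has_asymptotic_density (UNIV - sieved 1 [] R) (1 - c)"
    by (intro density_Diff density_UNIV) auto
  let ?C = "UNIV - sieved 1 [] R"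
  have C: "?C = {n. \<exists>p\<in>P. n \<in> bad_at p}" by (auto simp: sieved_def R)
  have "bad \<subseteq> ?C \<union> large_multiples K"
  proof
    fix n assume "n \<in> bad"
    then obtain p where p: "prime p" "p mod 4 = 3" "n \<in> bad_at p" by (auto simp: bad_def)
    show "n \<in> ?C \<union> large_multiples K"
    proof (cases "p \<in> P")
      case False
      obtain j where pj: "p = 4 * int j + 3"
        using int_3_mod_4_cases p(1,2) prime_gt_0_int by blast
      then have "j \<ge> K" using False p by (simp add: P_def)
      with p(3) pj show ?thesis by (auto simp: large_multiples_def bad_at_def)
    qed (use p C in auto)
  qed
  then have "card (bad \<inter> {1..N}) \<le> card (?C \<inter> {1..N}) + card (large_multiples K \<inter> {1..N})" for N
    by (intro order_trans[OF card_mono card_Un_Int_le]) auto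
  moreover have "real (card (large_multiples K \<inter> {1..N})) \<le> e * real N" for N
    using large_multiples_count_le[of K N] mult_right_mono[OF K, of "real N"] by (simp add: K_def)
  ultimately have "\<forall>N. real (card (bad \<inter> {1..N})) \<le> real (card (?C \<inter> {1..N})) + e * real N"
    by (smt (verit) of_nat_add of_nat_mono)
  moreover have "?C \<subseteq> bad" unfolding C by (auto simp: bad_def P_def)
  ultimately show "\<exists>C c. C \<subseteq> bad \<and> has_asymptotic_density C c \<and>
      (\<forall>N. real (card (bad \<inter> {1..N})) \<le> real (card (C \<inter> {1..N})) + e * real N)"
    using c by blast
qed

section \<open>Interval bounds for the density of a sieved set\<close>

text \<open>Fixed-point unit: densities are enclosed by integer multiples of \<open>10\<^sup>-\<^sup>1\<^sup>5\<close>.\<close>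

abbreviation scale :: int where
  "scale \<equiv> 1000000000000000"

text \<open>Interval version of the recursion \<open>sieved_Cons\<close>. The number of branches stays small because a set
whose modulus exceeds \<open>10\<^sup>8\<close> is not explored: its density is only enclosed between \<open>0\<close> and the
inverse of the modulus.\<close>

fun density_bounds :: "int \<Rightarrow> int list \<Rightarrow> int list \<Rightarrow> int \<times> int" where
  "density_bounds L S [] =
     (let v = scale * (\<Prod>p\<leftarrow>S. p - 1) div (L * (\<Prod>p\<leftarrow>S. p)) in (v, v + 1))"
| "density_bounds L S (q # R) =
     (let (l, h) = density_bounds L S R; L' = lcm L (q * (q * q - 1)) in
      if L' > 100000000 then (l - scale div L' - 1, h)
      else if \<exists>p\<in>set (q # S). p * p dvd L' then (l, h)
      else let (l', h') = density_bounds L' (q # S) R in (l - h', h - l'))"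

lemma scale_div_bound:
  assumes "L > 0"
  shows "1 / of_int L \<le> (of_int (scale div L + 1) / 10 ^ 15 :: real)"
proof -
  have "10 ^ 15 / of_int L \<le> (of_int (scale div L + 1) :: real)"
    using floor_divide_of_int_eq[of scale L, where 'a = real]
      floor_correct[of "of_int scale / of_int L :: real"] by simp
  then have "(10 ^ 15 / of_int L) / 10 ^ 15 \<le> (of_int (scale div L + 1) / 10 ^ 15 :: real)"
    by (intro divide_right_mono) auto
  then show ?thesis by simp
qed

lemma density_bounds_sound:
  assumes "has_asymptotic_density (sieved L S R) d"
    and "L > 0" "distinct (S @ R)" "\<And>p. p \<in> set S \<Longrightarrow> prime p \<and> p dvd L \<and> \<not> p * p dvd L"
    and "\<And>q. q \<in> set R \<Longrightarrow> prime q"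
    and "density_bounds L S R = (l, h)"
  shows "of_int l \<le> 10 ^ 15 * d \<and> 10 ^ 15 * d \<le> of_int h"
  using assms
proof (induction R arbitrary: L S d l h)
  case Nil
  let ?P = "\<Prod>p\<leftarrow>S. p - 1" and ?Q = "L * (\<Prod>p\<leftarrow>S. p)"
  have "has_asymptotic_density (sieved L S []) (of_int ?P / of_int ?Q)"
    using Nil by (intro density_sieved_Nil) auto
  then have d: "10 ^ 15 * d = of_int (scale * ?P) / of_int ?Q"
    using density_unique[OF Nil(1)] by simp
  have "l = scale * ?P div ?Q" "h = l + 1"
    using Nil(6) by (auto simp: Let_def)
  then show ?case unfolding d floor_divide_of_int_eq[symmetric, where 'a = real] by linarith
next
  case (Cons q R)
  define L' where "L' = lcm L (q * (q * q - 1))"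
  have q: "prime q" "q > 1" using Cons.prems by (simp_all add: prime_gt_1_int)
  have L': "L' > 0" using Cons.prems(2) q(2) unfolding L'_def by (intro lcm_sieve_modulus_pos)
  have dvd: "prime p \<and> p dvd L'" if "p \<in> set (q # S)" for p
    using that Cons.prems(4)[of p] q by (auto simp: L'_def intro: dvd_trans[OF _ dvd_lcm2] dvd_lcmI1)
  obtain a where a: "has_asymptotic_density (sieved L S R) a"
    using density_sieved_exists[of L S R] Cons.prems by auto
  obtain b where b: "has_asymptotic_density (sieved L' (q # S) R) b"
    using density_sieved_exists[of L' "q # S" R] Cons.prems dvd L' by auto
  have d: "d = a - b"
    using density_unique[OF Cons.prems(1)[unfolded sieved_Cons]]
      density_Diff[OF a b[unfolded L'_def] sieved_lcm_subset] by blast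
  obtain l1 h1 where r1: "density_bounds L S R = (l1, h1)" by fastforce
  have IH1: "of_int l1 \<le> 10 ^ 15 * a \<and> 10 ^ 15 * a \<le> of_int h1"
    using Cons.IH[OF a _ _ _ _ r1] Cons.prems by auto
  consider "L' > 100000000" | "L' \<le> 100000000" "\<exists>p\<in>set (q # S). p * p dvd L'"
    | "L' \<le> 100000000" "\<forall>p\<in>set (q # S). \<not> p * p dvd L'"
    by (meson linorder_le_less_linear)
  then show ?case
  proof cases
    case 1
    then have lh: "l = l1 - scale div L' - 1" "h = h1"
      using Cons.prems(6) r1 by (auto simp: Let_def L'_def)
    have "0 \<le> b" using density_mono[OF density_empty b] by simp
    moreover have "b \<le> 1 / of_int L'"
      using density_mono[OF b density_int_multiples[OF L'] sieved_subset_multiples] .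
    moreover have "1 / of_int L' \<le> (of_int (scale div L' + 1) / 10 ^ 15 :: real)"
      by (rule scale_div_bound[OF L'])
    ultimately show ?thesis using IH1 by (simp add: lh d algebra_simps)
  next
    case 2
    then have lh: "l = l1" "h = h1"
      using Cons.prems(6) r1 by (auto simp: Let_def L'_def)
    have "sieved L' (q # S) R = {}" using 2(2) sieved_empty_if_square_dvd by blast
    then have "b = 0" using b density_unique density_empty by metis
    then show ?thesis using IH1 by (simp add: lh d)
  next
    case 3
    obtain l2 h2 where r2: "density_bounds L' (q # S) R = (l2, h2)" by fastforce
    have lh: "l = l1 - h2" "h = h1 - l2"
      using Cons.prems(6) r1 r2 3 by (auto simp: Let_def L'_def)
    have "of_int l2 \<le> 10 ^ 15 * b \<and> 10 ^ 15 * b \<le> of_int h2"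
      using Cons.IH[OF b L' _ _ _ r2] Cons.prems dvd 3(2) by auto
    then show ?thesis using IH1 by (simp add: lh d algebra_simps)
  qed
qed

section \<open>Numerical estimate\<close>

text \<open>The primes \<open>p \<equiv> 3 (mod 4)\<close> above \<open>3\<close> for which the multiples of \<open>72\<close> in \<^term>\<open>bad_at p\<close> have density more
than \<open>2 \<cdot> 10\<^sup>-\<^sup>8\<close>. In decreasing order the sets refined most often, those of the small primes, are met
with the shortest remaining lists.\<close>

definition small_primes :: "int list" where
  "small_primes = [359, 307, 271, 251, 239, 227, 223, 211, 199, 191, 179, 167, 163, 151, 139,
     131, 127, 107, 103, 83, 79, 71, 67, 59, 47, 43, 31, 23, 19, 11, 7]"

text \<open>A superset of the remaining primes \<open>p \<equiv> 3 (mod 4)\<close> between \<open>7\<close> and \<open>899\<close>: sieving by a few small primes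
excludes most composite numbers, and the others only weaken the upper bound slightly.\<close>

definition medium_candidates :: "int list" where
  "medium_candidates = [m \<leftarrow> map (\<lambda>j. 4 * j + 3) [1..224].
     (\<forall>d\<in>set [3, 5, 7, 11, 13]. \<not> d dvd m) \<and> m \<notin> set small_primes]"

lemma density_bounds_small_primes:
  "density_bounds 72 [] small_primes = (12667157966366, 12667536148923)"
  by code_simp

lemma medium_candidates_sum:
  "(\<Sum>m\<leftarrow>medium_candidates. scale div lcm 72 (m * (m * m - 1)) + 1) = 255403898"
  by code_simp

lemma small_primes_prime: "q \<in> set small_primes \<Longrightarrow> prime q \<and> q mod 4 = 3 \<and> q \<ge> 7"
proof -
  have "list_all (\<lambda>q. prime q \<and> q mod 4 = 3 \<and> q \<ge> 7) small_primes"
    by code_simp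
  then show "q \<in> set small_primes \<Longrightarrow> prime q \<and> q mod 4 = 3 \<and> q \<ge> 7"
    by (auto simp: list_all_iff)
qed

lemma distinct_small_primes: "distinct small_primes"
  by (simp add: small_primes_def)

definition medium_multiples :: "nat set" where
  "medium_multiples = {n. \<exists>m\<in>set medium_candidates. lcm 72 (m * (m * m - 1)) dvd int n}"

lemma medium_multiples_count_le:
  "real (card (medium_multiples \<inter> {1..N})) \<le> 255403898 / 10 ^ 15 * real N"
proof -
  have bound: "real (card ({n. \<exists>m\<in>set ms. g m dvd int n} \<inter> {1..N})) \<le>
      of_int (\<Sum>m\<leftarrow>ms. scale div g m + 1) / 10 ^ 15 * real N"
    if "\<And>m. m \<in> set ms \<Longrightarrow> g m > 0" for ms and g :: "int \<Rightarrow> int"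
    using that
  proof (induction ms)
    case (Cons m ms)
    have split: "{n. \<exists>x\<in>set (m # ms). g x dvd int n} =
        {n. g m dvd int n} \<union> {n. \<exists>x\<in>set ms. g x dvd int n}" by auto
    have "real (card ({n. \<exists>x\<in>set (m # ms). g x dvd int n} \<inter> {1..N})) \<le>
        real (card ({n. g m dvd int n} \<inter> {1..N}))
        + real (card ({n. \<exists>x\<in>set ms. g x dvd int n} \<inter> {1..N}))"
      unfolding split of_nat_add[symmetric] of_nat_le_iff by (rule card_Un_Int_le)
    also have "real (card ({n. g m dvd int n} \<inter> {1..N})) \<le> real N / of_int (g m)"
      using Cons.prems by (intro int_multiples_count_le) auto
    also have "real N / of_int (g m) \<le> of_int (scale div g m + 1) / 10 ^ 15 * real N"
    proof -
      have "1 / of_int (g m) * real N \<le> of_int (scale div g m + 1) / 10 ^ 15 * real N"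
        using Cons.prems by (intro mult_right_mono scale_div_bound) auto
      then show ?thesis by simp
    qed
    finally show ?case using Cons by (simp add: ring_distribs add_divide_distrib)
  qed simp
  have "lcm 72 (m * (m * m - 1)) > 0" if "m \<in> set medium_candidates" for m
  proof -
    have "m > 1" using that by (auto simp: medium_candidates_def)
    then show ?thesis by (intro lcm_sieve_modulus_pos) auto
  qed
  from bound[of medium_candidates "\<lambda>m. lcm 72 (m * (m * m - 1))", OF this]
  show ?thesis unfolding medium_multiples_def medium_candidates_sum by simp
qed

lemma dvd_24_if_coprime_6:
  assumes "p mod 4 = (3::int)" "\<not> 3 dvd p"
  shows "24 dvd p * p - 1"
proof -
  have "p mod 24 \<in> {7, 11, 19, 23}" using assms by (auto; presburger)
  then have "(p mod 24) * (p mod 24) mod 24 = 1" by auto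
  then show ?thesis by (simp add: mod_mult_eq mod_eq_dvd_iff[symmetric])
qed

text \<open>The set contains the disjoint union of \<open>B\<^sub>3\<close> and the multiples of \<open>72\<close> that are bad at one of the chosen
primes, and exceeds it by at most the multiples counted for the medium and the large candidates. The
large ones start at \<open>4 \<cdot> 225 + 3 = 903\<close>.\<close>

lemma density_bad_bounds:
  assumes "has_asymptotic_density bad d"
  shows "0.028999 < d \<and> d \<le> 0.029"
proof -
  have distinct: "distinct ([] @ small_primes)" using distinct_small_primes by simp
  obtain x where x: "has_asymptotic_density (sieved 72 [] small_primes) x"
    using density_sieved_exists[OF _ distinct] small_primes_prime by fastforce
  have xb: "12667157966366 \<le> 10 ^ 15 * x" "10 ^ 15 * x \<le> 12667536148923"
    using density_bounds_sound[OF x _ distinct _ _ density_bounds_small_primes] small_primes_prime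
    by auto
  define E where "E = {n. 72 dvd int n} - sieved 72 [] small_primes"
  have E_iff: "n \<in> E \<longleftrightarrow> 72 dvd int n \<and> (\<exists>p\<in>set small_primes. n \<in> bad_at p)" for n
    by (auto simp: E_def sieved_def)
  have "has_asymptotic_density E (1 / 72 - x)"
    using density_Diff[OF density_int_multiples x sieved_subset_multiples] by (simp add: E_def)
  moreover have B3: "bad_at 3 = sieved 24 [3] []"
    by (auto simp: bad_at_def sieved_def)
  have "has_asymptotic_density (bad_at 3) (1 / 36)"
    using density_sieved_Nil[of 24 "[3]"] by (simp add: B3)
  moreover have "bad_at 3 \<inter> E = {}"
    using dvd_trans[of 9 "72 :: int"] by (auto simp: E_iff bad_at_def)
  ultimately have C: "has_asymptotic_density (bad_at 3 \<union> E) (1 / 36 + (1 / 72 - x))"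
    by (intro density_Un_disjoint)
  have in_bad: "n \<in> bad" if "prime p" "p mod 4 = 3" "n \<in> bad_at p" for n p
    unfolding bad_def using that by blast
  have "bad_at 3 \<union> E \<subseteq> bad"
  proof
    fix n assume "n \<in> bad_at 3 \<union> E"
    then obtain p where "n \<in> bad_at p" "p = 3 \<or> p \<in> set small_primes"
      by (auto simp: E_iff)
    then show "n \<in> bad" using in_bad[of p n] small_primes_prime[of p] by auto
  qed
  then have lower: "1 / 36 + (1 / 72 - x) \<le> d" by (rule density_mono[OF C assms])
  have cover: "bad \<subseteq> (bad_at 3 \<union> E) \<union> (medium_multiples \<union> large_multiples 225)"
  proof
    fix n assume "n \<in> bad"
    then obtain p where p: "prime p" "p mod 4 = 3" "n \<in> bad_at p" by (auto simp: bad_def)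
    have pn: "p * (p * p - 1) dvd int n" using p(3) by (simp add: bad_at_def)
    show "n \<in> (bad_at 3 \<union> E) \<union> (medium_multiples \<union> large_multiples 225)"
    proof (cases "p = 3 \<or> n \<in> bad_at 3")
      case True
      then show ?thesis using p(3) by auto
    next
      case False
      then have "\<not> 3 dvd p" using p(1) primes_dvd_imp_eq[of 3 p] by auto
      \<comment> \<open>\<open>24\<close> divides \<open>n\<close> but \<open>n\<close> is not in \<^term>\<open>bad_at 3\<close>, so \<open>9\<close> must divide \<open>n\<close>.\<close>
      then have "24 dvd p * p - 1" using p(2) by (rule dvd_24_if_coprime_6[rotated])
      then have 24: "24 dvd int n" using pn by (metis dvd_mult dvd_trans)
      with False have "9 dvd int n" by (auto simp: bad_at_def)
      with 24 have 72: "72 dvd int n" by presburger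
      obtain j where pj: "p = 4 * int j + 3"
        using int_3_mod_4_cases p(1,2) prime_gt_0_int by blast
      have "j \<ge> 1" using False pj by (cases j) auto
      consider "p \<in> set small_primes" | "j \<ge> 225" | "p \<notin> set small_primes" "j < 225" by linarith
      then show ?thesis
      proof cases
        case 1
        with p(3) 72 show ?thesis by (auto simp: E_iff)
      next
        case 2
        with pn pj show ?thesis by (auto simp: large_multiples_def)
      next
        case 3
        have "p \<notin> {3, 5, 7, 11, 13}"
          using 3(1) False p(2) by (auto simp: small_primes_def)
        then have "\<forall>q\<in>{3, 5, 7, 11, 13}. \<not> q dvd p"
          using p(1) primes_dvd_imp_eq[of 3 p] primes_dvd_imp_eq[of 5 p]
            primes_dvd_imp_eq[of 7 p] primes_dvd_imp_eq[of 11 p] primes_dvd_imp_eq[of 13 p]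
          by auto
        moreover have "p \<in> (\<lambda>j. 4 * j + 3) ` {1..224}"
          using pj \<open>j \<ge> 1\<close> 3(2) by (auto intro!: image_eqI[of _ _ "int j"])
        ultimately have "p \<in> set medium_candidates"
          using 3(1) by (simp add: medium_candidates_def)
        moreover have "lcm 72 (p * (p * p - 1)) dvd int n" using 72 pn by simp
        ultimately show ?thesis by (auto simp: medium_multiples_def)
      qed
    qed
  qed
  have "d \<le> (1 / 36 + (1 / 72 - x)) + (255403898 / 10 ^ 15 + 1 / (8 * (4 * real 225 + 1)\<^sup>2))"
  proof (rule density_le_add[OF assms C])
    fix N
    have "card (bad \<inter> {1..N}) \<le> card ((bad_at 3 \<union> E) \<inter> {1..N}) +
        (card (medium_multiples \<inter> {1..N}) + card (large_multiples 225 \<inter> {1..N}))"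
      using cover by (intro order_trans[OF card_mono order_trans[OF card_Un_Int_le
        add_left_mono[OF card_Un_Int_le]]]) auto
    then show "real (card (bad \<inter> {1..N})) \<le> real (card ((bad_at 3 \<union> E) \<inter> {1..N})) +
        (255403898 / 10 ^ 15 + 1 / (8 * (4 * real 225 + 1)\<^sup>2)) * real N"
      using medium_multiples_count_le[of N] large_multiples_count_le[of 225 N]
      unfolding ring_distribs by linarith
  qed
  then show ?thesis using lower xb by (simp add: power2_eq_square)
qed

theorem theorem5:
  shows "\<exists>d::real. has_asymptotic_density M_set d \<and> 0.971000 \<le> d \<and> d < 0.971001"
proof -
  obtain b where b: "has_asymptotic_density bad b" using density_bad_exists by blast
  have "(UNIV - bad) \<inter> {1..N} = M_set \<inter> {1..N}" for N by (auto simp: M_set_eq)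
  then have "has_asymptotic_density M_set (1 - b)"
    using density_Diff[OF density_UNIV b] by (simp add: has_asymptotic_density_def)
  with density_bad_bounds[OF b] show ?thesis by (intro exI[of _ "1 - b"]) auto
qed

end
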